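(* For every fixed SIDER level $n\ge2$ and every fixed expansion order $N$, the normal-coordinate error of the SIDER-$n$ interpolant of a smooth curve $\gamma$ in $\mathbb{S}^2$ has a shift-covariant filtered expansion $$\operatorname{Log}_{\gamma(\theta h)}P_i^{[n]}(\theta;h)=\sum_{r=0}^{N}h^r\,\mathcal{E}_{n,r}\bigl(\xi;\mathcal{J}_r(\gamma;\theta)\bigr)+O(h^{N+1}),\qquad \xi=\theta-i,$$ where each coefficient $\mathcal{E}_{n,r}(\xi;\mathcal{J}_r(\gamma;\theta))$ is a polynomial in $\xi$ of degree at most $r$, and the coefficient maps $\mathcal{E}_{n,r}$ are universal, depending on the stencil shift $i$ only through $\xi$. The remainder is uniform for $\xi$ in bounded intervals.
   Context: $\mathbb{S}^2=\{x\in\mathbb{R}^3:|x|=1\}$ with the induced Riemannian metric. $\operatorname{Exp}_y(v)=\cos|v|\,y+\frac{\sin|v|}{|v|}v$ for $v\in T_y\mathbb{S}^2=\{v\in\mathbb{R}^3:v\cdot y=0\}$ (with $\operatorname{Exp}_y(0)=y$). For $z$ not antipodal to $y$ and $\alpha=\arccos(y\cdot z)$, $\operatorname{Log}_y(z)=\frac{\alpha}{\sin\alpha}(z-(y\cdot z)y)$ (with $\operatorname{Log}_y(y)=0$). For non-antipodal $a,b\in\mathbb{S}^2$ and any real $\lambda$, $\operatorname{SLERP}(a,b,\lambda)=\operatorname{Exp}_a(\lambda\operatorname{Log}_a b)$, equivalently $\frac{\sin((1-\lambda)\alpha)}{\sin\alpha}a+\frac{\sin(\lambda\alpha)}{\sin\alpha}b$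 with $\alpha=\arccos(a\cdot b)\in(0,\pi)$. SIDER construction. Let $p_j=\gamma(jh)$. For a stencil beginning at index $i$, with $\tau=(\theta-i)/2$, $d_a=\operatorname{SLERP}(p_{i+2},p_{i+1},2)$, $d_b=\operatorname{SLERP}(p_i,p_{i+1},2)$, $$P_i^{[2]}(\theta;h)=\operatorname{SLERP}\bigl(\operatorname{SLERP}(p_i,d_a,\tau),\operatorname{SLERP}(d_b,p_{i+2},\tau),\tau\bigr).$$ For $k\ge3$, $P_i^{[k]}(\theta;h)=\operatorname{SLERP}\bigl(P_i^{[k-1]}(\theta;h),P_{i+1}^{[k-1]}(\theta;h),\frac{\theta-i}{k}\bigr)$. Notation: $\mathcal{J}_r(\gamma;\theta)$ is the local normal-coordinate jet of $\gamma$ up to order $r$ at the exact point, i.e. the derivatives $X^{(1)}(0),\dots,X^{(r)}(0)\in T_{\gamma(\theta h)}\mathbb{S}^2$ of $X(\eta)=\operatorname{Log}_{\gamma(\theta h)}\gamma(\theta h+\eta)$. "Universal" means that the maps $\mathcal{E}_{n,r}$ are fixed functions of $\xi$ and the jet, the same for all curves and all stencils. In "polynomial in $\xi$", the jet is held fixed. The coefficients take values in $T_{\gamma(\theta h)}\mathbb{S}^2$. Standing assumptions: $\gamma$ is a fixed smooth curve, $h\to0^+$ is small enough that all data points and all points generated by the SIDER-$n$ construction (including the extrapolated control points) lie in a common geodesically convex ball of radius $O(h)$, in which logarithms are single-valued and geodesics unique. *)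

theory Defs
  imports "HOL-Analysis.Analysis"
begin

abbreviation S2 :: "(real^3) set" where
  "S2 \<equiv> sphere 0 1"

definition tangent_S2 :: "real^3 \<Rightarrow> (real^3) set" where
  "tangent_S2 y = {v. v \<bullet> y = 0}"

definition Exp_S2 :: "real^3 \<Rightarrow> real^3 \<Rightarrow> real^3" where
  "Exp_S2 y v =
     (if v = 0 then y else cos (norm v) *\<^sub>R y + (sin (norm v) / norm v) *\<^sub>R v)"

text \<open>The value of \<open>Log_S2 y z\<close> is meaningful only for unit vectors that are not antipodal.\<close>

definition Log_S2 :: "real^3 \<Rightarrow> real^3 \<Rightarrow> real^3" where
  "Log_S2 y z =
     (if z = y then 0
      else (let \<alpha> = arccos (y \<bullet> z) in (\<alpha> / sin \<alpha>) *\<^sub>R (z - (y \<bullet> z) *\<^sub>R y)))"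

definition SLERP :: "real^3 \<Rightarrow> real^3 \<Rightarrow> real \<Rightarrow> real^3" where
  "SLERP a b t = Exp_S2 a (t *\<^sub>R Log_S2 a b)"

definition SIDER2 :: "(real \<Rightarrow> real^3) \<Rightarrow> real \<Rightarrow> int \<Rightarrow> real \<Rightarrow> real^3" where
  "SIDER2 \<gamma> h i \<theta> =
     (let p = (\<lambda>j::int. \<gamma> (of_int j * h));
          \<tau> = (\<theta> - of_int i) / 2;
          d\<^sub>a = SLERP (p (i + 2)) (p (i + 1)) 2;
          d\<^sub>b = SLERP (p i) (p (i + 1)) 2
      in SLERP (SLERP (p i) d\<^sub>a \<tau>) (SLERP d\<^sub>b (p (i + 2)) \<tau>) \<tau>)"

text \<open>The level \<open>k\<close> interpolant on the stencil starting at \<open>i\<close>; levels below 2 are junk.\<close>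

fun SIDER :: "(real \<Rightarrow> real^3) \<Rightarrow> real \<Rightarrow> nat \<Rightarrow> int \<Rightarrow> real \<Rightarrow> real^3" where
  "SIDER \<gamma> h k i \<theta> =
     (if k \<le> 2 then SIDER2 \<gamma> h i \<theta>
      else SLERP (SIDER \<gamma> h (k - 1) i \<theta>) (SIDER \<gamma> h (k - 1) (i + 1) \<theta>)
             ((\<theta> - of_int i) / of_nat k))"

declare SIDER.simps [simp del]

definition iter_deriv :: "nat \<Rightarrow> (real \<Rightarrow> real^3) \<Rightarrow> real \<Rightarrow> real^3" where
  "iter_deriv k f = ((\<lambda>g t. vector_derivative g (at t)) ^^ k) f"

text \<open>Meant for open \<open>I\<close>, where it says that all iterated derivatives exist.\<close>

definition smooth_curve_on :: "real set \<Rightarrow> (real \<Rightarrow> real^3) \<Rightarrow> bool" where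
  "smooth_curve_on I \<gamma> \<longleftrightarrow> (\<forall>k. \<forall>t\<in>I. iter_deriv k \<gamma> differentiable (at t))"

text \<open>The list \<open>[X'(0), \<dots>, X\<^sup>(\<^sup>r\<^sup>)(0)]\<close> of derivatives of the curve in normal
  coordinates about its own point \<open>\<gamma> t\<close>.\<close>

definition normal_jet :: "nat \<Rightarrow> (real \<Rightarrow> real^3) \<Rightarrow> real \<Rightarrow> (real^3) list" where
  "normal_jet r \<gamma> t =
     map (\<lambda>k. iter_deriv k (\<lambda>\<eta>. Log_S2 (\<gamma> t) (\<gamma> (t + \<eta>))) 0) [1..<Suc r]"

definition polynomial_deg_le :: "nat \<Rightarrow> (real^3) set \<Rightarrow> (real \<Rightarrow> real^3) \<Rightarrow> bool" where
  "polynomial_deg_le r V f \<longleftrightarrow>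
     (\<exists>c. (\<forall>k\<le>r. c k \<in> V) \<and> (\<forall>x. f x = (\<Sum>k\<le>r. x ^ k *\<^sub>R c k)))"

end

theory Submission
  imports Defs
begin

text \<open>Each point of the construction is written in the fixed model space \<open>\<real> \<times> \<real>\<^sup>3\<close>, with
  \<open>\<gamma> (\<theta> h)\<close> as the pole \<open>(1, 0)\<close> and the tangent space as the second factor, and is expanded in
  powers of \<open>h\<close>. An expansion has defect \<open>d\<close> if its coefficient of \<open>h\<^sup>r\<close> has degree at most
  \<open>r - d\<close> in \<open>\<xi>\<close>. Defects add up under products and survive composition with power series, and the
  interpolation weight \<open>\<xi> / k\<close> lowers the defect by one. Passing to the next stencil
  replaces \<open>\<xi>\<close> by \<open>\<xi> - 1\<close>, so that the difference of neighbouring interpolants has defect one; hence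
  the weighted logarithm inside \<open>SLERP\<close> has defect zero again. At level 2 the two inner interpolants are
  not shifts of each other. Their difference has defect one because, up to defect two, the difference of
  their initial velocities is a second difference of the data.\<close>

section \<open>Uniform expansions in the step size\<close>

text \<open>The order of quantifiers shapes the setup. The coefficient maps are to be fixed before
  the curve, so every quantity is a single function on configurations, curve included, and only the
  constants in the bounds depend on the curve, on \<open>K\<close> and on the window for \<xi>. The
  base point has to disappear too, since a coefficient sees the jet but not the point it is taken
  at. Rotating to a common pole would bring in a frame of each tangent space. The model space has
  one dimension more, so tangent vectors stay as they are, and tangency of a coefficient becomes
  membership in the span of the jet.

  The norm and arccos are not smooth at coinciding points, around which everything is expanded.
  Hence \<open>SLERP\<close> is rewritten with power series in inner products: cos and sinc in the
  squared length of the tangent vector, \<alpha> / sin \<alpha> in half the squared chord. These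
  formulas apply to nearby points, and nearness is read off from the expansions themselves: a defect
  bounds the order in h from below.

  To compare the two inner curves of level 2, the logarithm is replaced by the difference of the
  endpoints up to defect two, because the weight consumes one.\<close>

text \<open>A configuration consists of the curve, the step size \<open>h\<close>, the parameter \<open>t = \<theta> h\<close> of the exact
  point and \<open>\<xi> = \<theta> - i\<close>. The stencil index \<open>i\<close> then enters only through \<open>\<xi>\<close>, as the data
  points are \<open>p\<^sub>i\<^sub>+\<^sub>m = \<gamma> (t + (m - \<xi>) h)\<close>.\<close>

datatype cfg = Cfg (crv: "real \<Rightarrow> real^3") (stp: real) (tm: real) (xi: real)

text \<open>The pair (t, \<xi>) sits in a principal factor: the threshold on h is chosen first, so
  an eventual bound is uniform over \<open>K\<close> and \<open>{a..b}\<close>. Here \<xi> ranges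
  over reals independently of t, without tying t / h - \<xi> to an integer i; this leaves it free to
  be shifted.\<close>

definition flt :: "(real \<Rightarrow> real^3) \<Rightarrow> real set \<Rightarrow> real \<Rightarrow> real \<Rightarrow> cfg filter" where
  "flt \<gamma> K a b = filtermap (\<lambda>(h, t, x). Cfg \<gamma> h t x) (at_right 0 \<times>\<^sub>F principal (K \<times> {a..b}))"

lemma eventually_prod_principal_iff:
  "eventually P (F \<times>\<^sub>F principal A) \<longleftrightarrow> (\<forall>\<^sub>F x in F. \<forall>y\<in>A. P (x, y))"
proof
  assume "eventually P (F \<times>\<^sub>F principal A)"
  then obtain Q R where "eventually Q F" "\<forall>y\<in>A. R y" "\<forall>x y. Q x \<longrightarrow> R y \<longrightarrow> P (x, y)"
    unfolding eventually_prod_filter eventually_principal by blast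
  then show "\<forall>\<^sub>F x in F. \<forall>y\<in>A. P (x, y)" by (auto elim: eventually_mono)
next
  assume "\<forall>\<^sub>F x in F. \<forall>y\<in>A. P (x, y)"
  then show "eventually P (F \<times>\<^sub>F principal A)"
    unfolding eventually_prod_filter eventually_principal
    by (intro exI[of _ "\<lambda>x. \<forall>y\<in>A. P (x, y)"] exI[of _ "\<lambda>y. y \<in> A"]) blast
qed

lemma eventually_flt:
  "eventually P (flt \<gamma> K a b) \<longleftrightarrow> (\<forall>\<^sub>F h in at_right 0. \<forall>t\<in>K. \<forall>x\<in>{a..b}. P (Cfg \<gamma> h t x))"
  unfolding flt_def eventually_filtermap eventually_prod_principal_iff by simp

definition admissible :: "(real \<Rightarrow> real^3) \<Rightarrow> real set \<Rightarrow> bool" where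
  "admissible \<gamma> K \<longleftrightarrow> (\<exists>I. open I \<and> is_interval I \<and> smooth_curve_on I \<gamma> \<and> \<gamma> ` I \<subseteq> S2 \<and>
     compact K \<and> K \<subseteq> I)"

definition uev :: "(cfg \<Rightarrow> bool) \<Rightarrow> bool" where
  "uev P \<longleftrightarrow> (\<forall>\<gamma> K a b. admissible \<gamma> K \<longrightarrow> eventually P (flt \<gamma> K a b))"

text \<open>\<open>F\<close> is one function for all curves, while \<open>C\<close> is chosen after
  the curve, \<open>K\<close> and the window for \<xi>. Coefficients chosen outside of this
  predicate, as in \<open>filtered\<close>, are therefore common to all curves.\<close>

definition bigO :: "nat \<Rightarrow> (cfg \<Rightarrow> 'v::real_normed_vector) \<Rightarrow> bool" where
  "bigO m F \<longleftrightarrow> (\<forall>\<gamma> K a b. admissible \<gamma> K \<longrightarrow>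
     (\<exists>C. eventually (\<lambda>\<omega>. norm (F \<omega>) \<le> C * stp \<omega> ^ m) (flt \<gamma> K a b)))"

lemma uev_conj: "uev P \<Longrightarrow> uev Q \<Longrightarrow> uev (\<lambda>\<omega>. P \<omega> \<and> Q \<omega>)"
  by (simp add: uev_def eventually_conj_iff)

lemma uev_mono: "uev P \<Longrightarrow> (\<And>\<omega>. P \<omega> \<Longrightarrow> Q \<omega>) \<Longrightarrow> uev Q"
  unfolding uev_def using eventually_mono by blast

lemma uev_stp: "uev (\<lambda>\<omega>. 0 < stp \<omega> \<and> stp \<omega> < d)" if "d > 0"
  unfolding uev_def eventually_flt
proof (intro allI impI)
  fix \<gamma> :: "real \<Rightarrow> real^3" and K :: "real set" and a b :: real
  have "\<forall>\<^sub>F h in at_right 0. 0 < (h::real) \<and> h < d"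
    using that by (auto simp: eventually_at_right_field intro!: exI[of _ d])
  then show "\<forall>\<^sub>F h in at_right 0. \<forall>t\<in>K. \<forall>x\<in>{a..b}. 0 < stp (Cfg \<gamma> h t x) \<and> stp (Cfg \<gamma> h t x) < d"
    by eventually_elim auto
qed

lemma bigO_intro:
  assumes "\<And>\<gamma> K a b. admissible \<gamma> K \<Longrightarrow>
     \<exists>C. eventually (\<lambda>\<omega>. 0 < stp \<omega> \<and> stp \<omega> < 1 \<longrightarrow> norm (F \<omega>) \<le> C * stp \<omega> ^ m) (flt \<gamma> K a b)"
  shows "bigO m F"
  unfolding bigO_def
proof (intro allI impI)
  fix \<gamma> K a b assume adm: "admissible \<gamma> K"
  then obtain C where C: "eventually (\<lambda>\<omega>. 0 < stp \<omega> \<and> stp \<omega> < 1 \<longrightarrow> norm (F \<omega>) \<le> C * stp \<omega> ^ m)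
    (flt \<gamma> K a b)" using assms by blast
  have "eventually (\<lambda>\<omega>. 0 < stp \<omega> \<and> stp \<omega> < 1) (flt \<gamma> K a b)"
    using uev_stp[of 1] adm unfolding uev_def by auto
  with C have "eventually (\<lambda>\<omega>. norm (F \<omega>) \<le> C * stp \<omega> ^ m) (flt \<gamma> K a b)"
    by eventually_elim auto
  then show "\<exists>C. eventually (\<lambda>\<omega>. norm (F \<omega>) \<le> C * stp \<omega> ^ m) (flt \<gamma> K a b)" by blast
qed

lemma bigO_elim:
  assumes "bigO m F" "admissible \<gamma> K"
  obtains C where "C \<ge> 0"
    "eventually (\<lambda>\<omega>. 0 < stp \<omega> \<and> stp \<omega> < 1 \<and> norm (F \<omega>) \<le> C * stp \<omega> ^ m) (flt \<gamma> K a b)"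
proof -
  obtain C where C: "eventually (\<lambda>\<omega>. norm (F \<omega>) \<le> C * stp \<omega> ^ m) (flt \<gamma> K a b)"
    using assms unfolding bigO_def by blast
  have "eventually (\<lambda>\<omega>. 0 < stp \<omega> \<and> stp \<omega> < 1) (flt \<gamma> K a b)"
    using uev_stp[of 1] assms unfolding uev_def by auto
  with C have "eventually (\<lambda>\<omega>. 0 < stp \<omega> \<and> stp \<omega> < 1 \<and> norm (F \<omega>) \<le> max C 0 * stp \<omega> ^ m) (flt \<gamma> K a b)"
  proof eventually_elim
    case (elim \<omega>)
    have "C * stp \<omega> ^ m \<le> max C 0 * stp \<omega> ^ m"
      using elim by (intro mult_right_mono) auto
    with elim show ?case by linarith
  qed
  then show ?thesis using that[of "max C 0"] by auto
qed

lemma bigO_cong: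
  assumes "uev (\<lambda>\<omega>. F \<omega> = G \<omega>)" "bigO m F"
  shows "bigO m G"
proof (rule bigO_intro)
  fix \<gamma> K a b assume adm: "admissible \<gamma> K"
  obtain C where C: "C \<ge> 0" "eventually (\<lambda>\<omega>. 0 < stp \<omega> \<and> stp \<omega> < 1 \<and> norm (F \<omega>) \<le> C * stp \<omega> ^ m) (flt \<gamma> K a b)"
    by (rule bigO_elim[OF assms(2) adm])
  have "eventually (\<lambda>\<omega>. F \<omega> = G \<omega>) (flt \<gamma> K a b)" using assms(1) adm unfolding uev_def by blast
  with C(2) have "eventually (\<lambda>\<omega>. 0 < stp \<omega> \<and> stp \<omega> < 1 \<longrightarrow> norm (G \<omega>) \<le> C * stp \<omega> ^ m) (flt \<gamma> K a b)"
    by eventually_elim auto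
  then show "\<exists>C. eventually (\<lambda>\<omega>. 0 < stp \<omega> \<and> stp \<omega> < 1 \<longrightarrow> norm (G \<omega>) \<le> C * stp \<omega> ^ m) (flt \<gamma> K a b)"
    by blast
qed

lemma bigO_bound:
  assumes "bigO m F" "uev (\<lambda>\<omega>. norm (G \<omega>) \<le> B * norm (F \<omega>))" "B \<ge> 0"
  shows "bigO m G"
proof (rule bigO_intro)
  fix \<gamma> K a b assume adm: "admissible \<gamma> K"
  obtain C where C: "C \<ge> 0" "eventually (\<lambda>\<omega>. 0 < stp \<omega> \<and> stp \<omega> < 1 \<and> norm (F \<omega>) \<le> C * stp \<omega> ^ m) (flt \<gamma> K a b)"
    by (rule bigO_elim[OF assms(1) adm])
  have "eventually (\<lambda>\<omega>. norm (G \<omega>) \<le> B * norm (F \<omega>)) (flt \<gamma> K a b)"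
    using assms(2) adm unfolding uev_def by blast
  with C(2) have "eventually (\<lambda>\<omega>. 0 < stp \<omega> \<and> stp \<omega> < 1 \<longrightarrow> norm (G \<omega>) \<le> (B * C) * stp \<omega> ^ m) (flt \<gamma> K a b)"
  proof eventually_elim
    case (elim \<omega>)
    have "B * norm (F \<omega>) \<le> B * (C * stp \<omega> ^ m)" using elim assms(3) by (intro mult_left_mono) auto
    with elim show ?case by (auto simp: mult.assoc)
  qed
  then show "\<exists>C. eventually (\<lambda>\<omega>. 0 < stp \<omega> \<and> stp \<omega> < 1 \<longrightarrow> norm (G \<omega>) \<le> C * stp \<omega> ^ m) (flt \<gamma> K a b)"
    by blast
qed

lemma bigO_bilinear:
  fixes F :: "cfg \<Rightarrow> 'a::real_normed_vector" and G :: "cfg \<Rightarrow> 'b::real_normed_vector"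
    and B :: "'a \<Rightarrow> 'b \<Rightarrow> 'c::real_normed_vector"
  assumes "bounded_bilinear B" "bigO m F" "bigO n G"
  shows "bigO (m + n) (\<lambda>\<omega>. B (F \<omega>) (G \<omega>))"
proof (rule bigO_intro)
  fix \<gamma> K a b assume adm: "admissible \<gamma> K"
  obtain C where C: "C \<ge> 0" "eventually (\<lambda>\<omega>. 0 < stp \<omega> \<and> stp \<omega> < 1 \<and> norm (F \<omega>) \<le> C * stp \<omega> ^ m) (flt \<gamma> K a b)"
    by (rule bigO_elim[OF assms(2) adm])
  obtain D where D: "D \<ge> 0" "eventually (\<lambda>\<omega>. 0 < stp \<omega> \<and> stp \<omega> < 1 \<and> norm (G \<omega>) \<le> D * stp \<omega> ^ n) (flt \<gamma> K a b)"
    by (rule bigO_elim[OF assms(3) adm])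
  obtain M where M: "M > 0" "\<And>u v. norm (B u v) \<le> norm u * norm v * M"
    using bounded_bilinear.pos_bounded[OF assms(1)] by blast
  from C(2) D(2) have "eventually (\<lambda>\<omega>. 0 < stp \<omega> \<and> stp \<omega> < 1 \<longrightarrow>
      norm (B (F \<omega>) (G \<omega>)) \<le> (C * D * M) * stp \<omega> ^ (m + n)) (flt \<gamma> K a b)"
  proof eventually_elim
    case (elim \<omega>)
    have "norm (F \<omega>) * norm (G \<omega>) \<le> (C * stp \<omega> ^ m) * (D * stp \<omega> ^ n)"
      using elim C(1) by (intro mult_mono) auto
    then have "norm (F \<omega>) * norm (G \<omega>) * M \<le> (C * stp \<omega> ^ m) * (D * stp \<omega> ^ n) * M"
      using M(1) by (intro mult_right_mono) auto
    with M(2)[of "F \<omega>" "G \<omega>"] show ?case by (simp add: power_add algebra_simps)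
  qed
  then show "\<exists>C. eventually (\<lambda>\<omega>. 0 < stp \<omega> \<and> stp \<omega> < 1 \<longrightarrow> norm (B (F \<omega>) (G \<omega>)) \<le> C * stp \<omega> ^ (m + n)) (flt \<gamma> K a b)"
    by blast
qed

lemma bigO_add:
  assumes "bigO m F" "bigO m G"
  shows "bigO m (\<lambda>\<omega>. F \<omega> + G \<omega>)"
proof (rule bigO_intro)
  fix \<gamma> K a b assume adm: "admissible \<gamma> K"
  obtain C where C: "C \<ge> 0" "eventually (\<lambda>\<omega>. 0 < stp \<omega> \<and> stp \<omega> < 1 \<and> norm (F \<omega>) \<le> C * stp \<omega> ^ m) (flt \<gamma> K a b)"
    by (rule bigO_elim[OF assms(1) adm])
  obtain D where D: "D \<ge> 0" "eventually (\<lambda>\<omega>. 0 < stp \<omega> \<and> stp \<omega> < 1 \<and> norm (G \<omega>) \<le> D * stp \<omega> ^ m) (flt \<gamma> K a b)"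
    by (rule bigO_elim[OF assms(2) adm])
  from C(2) D(2) have "eventually (\<lambda>\<omega>. 0 < stp \<omega> \<and> stp \<omega> < 1 \<longrightarrow>
      norm (F \<omega> + G \<omega>) \<le> (C + D) * stp \<omega> ^ m) (flt \<gamma> K a b)"
  proof eventually_elim
    case (elim \<omega>)
    then show ?case using norm_triangle_ineq[of "F \<omega>" "G \<omega>"] by (simp add: distrib_right)
  qed
  then show "\<exists>C. eventually (\<lambda>\<omega>. 0 < stp \<omega> \<and> stp \<omega> < 1 \<longrightarrow> norm (F \<omega> + G \<omega>) \<le> C * stp \<omega> ^ m) (flt \<gamma> K a b)"
    by blast
qed

lemma bigO_mono:
  assumes "bigO m F" "n \<le> m"
  shows "bigO n F"
proof (rule bigO_intro)
  fix \<gamma> K a b assume adm: "admissible \<gamma> K"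
  obtain C where C: "C \<ge> 0" "eventually (\<lambda>\<omega>. 0 < stp \<omega> \<and> stp \<omega> < 1 \<and> norm (F \<omega>) \<le> C * stp \<omega> ^ m) (flt \<gamma> K a b)"
    by (rule bigO_elim[OF assms(1) adm])
  from C(2) have "eventually (\<lambda>\<omega>. 0 < stp \<omega> \<and> stp \<omega> < 1 \<longrightarrow> norm (F \<omega>) \<le> C * stp \<omega> ^ n) (flt \<gamma> K a b)"
  proof eventually_elim
    case (elim \<omega>)
    have "C * stp \<omega> ^ m \<le> C * stp \<omega> ^ n"
      using elim C(1) assms(2) by (intro mult_left_mono power_decreasing) auto
    with elim show ?case by auto
  qed
  then show "\<exists>C. eventually (\<lambda>\<omega>. 0 < stp \<omega> \<and> stp \<omega> < 1 \<longrightarrow> norm (F \<omega>) \<le> C * stp \<omega> ^ n) (flt \<gamma> K a b)"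
    by blast
qed

lemma bigO_zero [simp]: "bigO m (\<lambda>\<omega>. 0)"
  by (rule bigO_intro) (auto intro!: exI[of _ 0])

lemma bigO_const: "bigO 0 (\<lambda>\<omega>. v)"
  by (rule bigO_intro) (auto intro!: exI[of _ "norm v"])

lemma bigO_stp: "bigO m (\<lambda>\<omega>. stp \<omega> ^ m)"
  by (rule bigO_intro) (auto intro!: exI[of _ 1])

lemma bigO_xi: "bigO 0 xi"
proof (rule bigO_intro)
  fix \<gamma> K a b
  show "\<exists>C. eventually (\<lambda>\<omega>. 0 < stp \<omega> \<and> stp \<omega> < 1 \<longrightarrow> norm (xi \<omega>) \<le> C * stp \<omega> ^ 0) (flt \<gamma> K a b)"
    by (rule exI[of _ "max \<bar>a\<bar> \<bar>b\<bar>"]) (auto simp: eventually_flt intro!: always_eventually)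
qed

lemma bigO_scaleR: "bigO m F \<Longrightarrow> bigO n G \<Longrightarrow> bigO (m + n) (\<lambda>\<omega>. F \<omega> *\<^sub>R G \<omega>)"
  by (rule bigO_bilinear[OF bounded_bilinear_scaleR])

lemma bigO_linear:
  assumes "bounded_linear T" "bigO m F"
  shows "bigO m (\<lambda>\<omega>. T (F \<omega>))"
proof -
  obtain M where "M > 0" "\<And>x. norm (T x) \<le> norm x * M"
    using bounded_linear.pos_bounded[OF assms(1)] by blast
  then show ?thesis
    by (intro bigO_bound[OF assms(2), of _ M]) (auto simp: uev_def mult.commute)
qed

lemma bigO_minus: "bigO m F \<Longrightarrow> bigO m G \<Longrightarrow> bigO m (\<lambda>\<omega>. F \<omega> - G \<omega>)"
  using bigO_add[of m F "\<lambda>\<omega>. - G \<omega>"] bigO_linear[OF bounded_linear_minus[OF bounded_linear_ident], of m G]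
  by simp

lemma bigO_sum: "(\<And>i. i \<in> A \<Longrightarrow> bigO m (F i)) \<Longrightarrow> bigO m (\<lambda>\<omega>. \<Sum>i\<in>A. F i \<omega>)"
  by (induction A rule: infinite_finite_induct) (auto intro: bigO_add)

lemma bigO_1_small:
  fixes F :: "cfg \<Rightarrow> 'v::real_normed_vector"
  assumes "bigO 1 F" "d > 0"
  shows "uev (\<lambda>\<omega>. norm (F \<omega>) < d)"
  unfolding uev_def
proof (intro allI impI)
  fix \<gamma> K a b assume adm: "admissible \<gamma> K"
  obtain C where C: "C \<ge> 0" "eventually (\<lambda>\<omega>. 0 < stp \<omega> \<and> stp \<omega> < 1 \<and> norm (F \<omega>) \<le> C * stp \<omega> ^ 1) (flt \<gamma> K a b)"
    by (rule bigO_elim[OF assms(1) adm])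
  \<comment> \<open>The summand 1 keeps the divisor positive when \<open>C = 0\<close>.\<close>
  have "eventually (\<lambda>\<omega>. 0 < stp \<omega> \<and> stp \<omega> < d / (C + 1)) (flt \<gamma> K a b)"
    using uev_stp[of "d / (C+1)"] C(1) assms(2) adm unfolding uev_def by auto
  with C(2) show "eventually (\<lambda>\<omega>. norm (F \<omega>) < d) (flt \<gamma> K a b)"
  proof eventually_elim
    case (elim \<omega>)
    then have "(C + 1) * stp \<omega> < d" using C(1) by (simp add: field_simps)
    with elim show ?case by (simp add: algebra_simps)
  qed
qed

definition shift :: "cfg \<Rightarrow> cfg" where
  "shift \<omega> = Cfg (crv \<omega>) (stp \<omega>) (tm \<omega>) (xi \<omega> - 1)"

lemma shift_sel [simp]: "crv (shift \<omega>) = crv \<omega>" "stp (shift \<omega>) = stp \<omega>" "tm (shift \<omega>) = tm \<omega>"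
  "xi (shift \<omega>) = xi \<omega> - 1"
  by (simp_all add: shift_def)

text \<open>The shift moves the window for \<xi> by one. This is harmless because \<open>uev\<close>
  and \<open>bigO\<close> quantify over windows in every position.\<close>

lemma eventually_flt_shift:
  assumes "eventually P (flt \<gamma> K (a - 1) (b - 1))"
  shows "eventually (\<lambda>\<omega>. P (shift \<omega>)) (flt \<gamma> K a b)"
  using assms unfolding eventually_flt shift_def by eventually_elim auto

lemma uev_shift: "uev P \<Longrightarrow> uev (\<lambda>\<omega>. P (shift \<omega>))"
  unfolding uev_def by (blast intro: eventually_flt_shift)

lemma bigO_shift: "bigO m F \<Longrightarrow> bigO m (\<lambda>\<omega>. F (shift \<omega>))"
  unfolding bigO_def
proof (intro allI impI)
  fix \<gamma> K a b assume *: "\<forall>\<gamma> K a b. admissible \<gamma> K \<longrightarrow>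
     (\<exists>C. eventually (\<lambda>\<omega>. norm (F \<omega>) \<le> C * stp \<omega> ^ m) (flt \<gamma> K a b))" "admissible \<gamma> K"
  then obtain C where "eventually (\<lambda>\<omega>. norm (F \<omega>) \<le> C * stp \<omega> ^ m) (flt \<gamma> K (a - 1) (b - 1))" by blast
  from eventually_flt_shift[OF this]
  show "\<exists>C. eventually (\<lambda>\<omega>. norm (F (shift \<omega>)) \<le> C * stp \<omega> ^ m) (flt \<gamma> K a b)" by auto
qed

section \<open>Asymptotic expansions with bounded, configuration-dependent coefficients\<close>

definition expands :: "(cfg \<Rightarrow> 'v::real_normed_vector) \<Rightarrow> (nat \<Rightarrow> cfg \<Rightarrow> 'v) \<Rightarrow> bool" where
  "expands F e \<longleftrightarrow> (\<forall>r. bigO 0 (e r)) \<and>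
     (\<forall>N. bigO (Suc N) (\<lambda>\<omega>. F \<omega> - (\<Sum>r\<le>N. stp \<omega> ^ r *\<^sub>R e r \<omega>)))"

lemma expands_coeff: "expands F e \<Longrightarrow> bigO 0 (e r)"
  by (simp add: expands_def)

lemma expands_remainder: "expands F e \<Longrightarrow> bigO (Suc N) (\<lambda>\<omega>. F \<omega> - (\<Sum>r\<le>N. stp \<omega> ^ r *\<^sub>R e r \<omega>))"
  by (simp add: expands_def)

lemma expands_partial_sum: "expands F e \<Longrightarrow> bigO 0 (\<lambda>\<omega>. \<Sum>r\<le>N. stp \<omega> ^ r *\<^sub>R e r \<omega>)"
  by (intro bigO_sum bigO_mono[OF bigO_scaleR[OF bigO_stp expands_coeff]]) auto

lemma expands_bigO:
  assumes "expands F e" "\<And>r. r < m \<Longrightarrow> e r = (\<lambda>\<omega>. 0)"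
  shows "bigO m F"
proof -
  have "bigO m (\<lambda>\<omega>. F \<omega> - (\<Sum>r\<le>m. stp \<omega> ^ r *\<^sub>R e r \<omega>))"
    by (rule bigO_mono[OF expands_remainder[OF assms(1)]]) auto
  moreover have "bigO m (\<lambda>\<omega>. \<Sum>r\<le>m. stp \<omega> ^ r *\<^sub>R e r \<omega>)"
  proof (rule bigO_sum)
    fix r assume "r \<in> {..m}"
    then consider "r = m" | "r < m" by force
    then show "bigO m (\<lambda>\<omega>. stp \<omega> ^ r *\<^sub>R e r \<omega>)"
      using bigO_scaleR[OF bigO_stp[of m] expands_coeff[OF assms(1), of m]] assms(2) by cases auto
  qed
  ultimately show ?thesis using bigO_add by fastforce
qed

lemma expands_add:
  assumes "expands F e" "expands G f"
  shows "expands (\<lambda>\<omega>. F \<omega> + G \<omega>) (\<lambda>r \<omega>. e r \<omega> + f r \<omega>)"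
  unfolding expands_def
proof (intro conjI allI)
  show "bigO 0 (\<lambda>\<omega>. e r \<omega> + f r \<omega>)" for r using assms by (intro bigO_add expands_coeff)
  show "bigO (Suc N) (\<lambda>\<omega>. F \<omega> + G \<omega> - (\<Sum>r\<le>N. stp \<omega> ^ r *\<^sub>R (e r \<omega> + f r \<omega>)))" for N
    using bigO_add[OF assms[THEN expands_remainder, of N]]
    by (simp add: scaleR_add_right sum.distrib algebra_simps)
qed

lemma expands_linear:
  assumes "bounded_linear T" "expands F e"
  shows "expands (\<lambda>\<omega>. T (F \<omega>)) (\<lambda>r \<omega>. T (e r \<omega>))"
proof -
  interpret bounded_linear T by fact
  show ?thesis unfolding expands_def
    using bigO_linear[OF assms(1) expands_coeff[OF assms(2)]]
      bigO_linear[OF assms(1) expands_remainder[OF assms(2)]]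
    by (simp add: diff sum scaleR)
qed

text \<open>Cauchy product. The product of the two truncations runs over a square of exponents; its
  part with r + s > N joins the remainder, together with \<open>B (F - FN) G\<close> and
  \<open>B FN (G - GN)\<close>.\<close>

lemma expands_bilinear:
  fixes B :: "'a::real_normed_vector \<Rightarrow> 'b::real_normed_vector \<Rightarrow> 'c::real_normed_vector"
  assumes B: "bounded_bilinear B" and F: "expands F e" and G: "expands G f"
  shows "expands (\<lambda>\<omega>. B (F \<omega>) (G \<omega>)) (\<lambda>r \<omega>. \<Sum>s\<le>r. B (e s \<omega>) (f (r - s) \<omega>))"
  unfolding expands_def
proof (intro conjI allI)
  interpret bounded_bilinear B by fact
  show "bigO 0 (\<lambda>\<omega>. \<Sum>s\<le>r. B (e s \<omega>) (f (r - s) \<omega>))" for r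
    using bigO_bilinear[OF B expands_coeff[OF F] expands_coeff[OF G]] by (intro bigO_sum) auto
  fix N
  define FN where "FN \<omega> = (\<Sum>r\<le>N. stp \<omega> ^ r *\<^sub>R e r \<omega>)" for \<omega>
  define GN where "GN \<omega> = (\<Sum>r\<le>N. stp \<omega> ^ r *\<^sub>R f r \<omega>)" for \<omega>
  define T where "T \<omega> = (\<lambda>(r, s). stp \<omega> ^ (r + s) *\<^sub>R B (e r \<omega>) (f s \<omega>))" for \<omega>
  have prod: "B (FN \<omega>) (GN \<omega>) = sum (T \<omega>) ({..N} \<times> {..N})" for \<omega>
    unfolding FN_def GN_def T_def sum_left sum_right
    by (subst sum.swap) (simp add: sum.cartesian_product scaleR_left scaleR_right power_add mult.commute)
  have tri: "(\<Sum>r\<le>N. stp \<omega> ^ r *\<^sub>R (\<Sum>s\<le>r. B (e s \<omega>) (f (r - s) \<omega>)))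
      = sum (T \<omega>) {(r, s). r + s \<le> N}" for \<omega>
  proof -
    have "sum (T \<omega>) {(r, s). r + s \<le> N} = (\<Sum>r\<le>N. \<Sum>s\<le>r. T \<omega> (s, r - s))"
      using sum.triangle_reindex_eq[of "\<lambda>r s. T \<omega> (r, s)" N] by simp
    also have "\<dots> = (\<Sum>r\<le>N. stp \<omega> ^ r *\<^sub>R (\<Sum>s\<le>r. B (e s \<omega>) (f (r - s) \<omega>)))"
      unfolding T_def scaleR_sum_right by (intro sum.cong) auto
    finally show ?thesis by simp
  qed
  have split: "sum (T \<omega>) ({..N} \<times> {..N}) = sum (T \<omega>) {(r, s). r + s \<le> N}
      + sum (T \<omega>) {(r, s). r \<le> N \<and> s \<le> N \<and> N < r + s}" for \<omega>
  proof -
    have fin: "finite {(r, s). r + s \<le> N}" "finite {(r, s). r \<le> N \<and> s \<le> N \<and> N < r + s}"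
      by (rule finite_subset[of _ "{..N} \<times> {..N}"]; auto)+
    have "{..N} \<times> {..N} = {(r, s). r + s \<le> N} \<union> {(r, s). r \<le> N \<and> s \<le> N \<and> N < r + s}" by auto
    then show ?thesis using fin by (simp only:) (rule sum.union_disjoint, auto)
  qed
  have "B (F \<omega>) (G \<omega>) - (\<Sum>r\<le>N. stp \<omega> ^ r *\<^sub>R (\<Sum>s\<le>r. B (e s \<omega>) (f (r - s) \<omega>)))
     = sum (T \<omega>) {(r, s). r \<le> N \<and> s \<le> N \<and> N < r + s}
       + (B (F \<omega> - FN \<omega>) (G \<omega>) + B (FN \<omega>) (G \<omega> - GN \<omega>))" for \<omega>
    unfolding tri using prod[of \<omega>] split[of \<omega>] by (simp add: diff_left diff_right algebra_simps)
  moreover have "bigO (Suc N) (\<lambda>\<omega>. B (F \<omega> - FN \<omega>) (G \<omega>))"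
    using bigO_bilinear[OF B expands_remainder[OF F, of N] expands_bigO[OF G, of 0]] by (simp add: FN_def)
  moreover have "bigO (Suc N) (\<lambda>\<omega>. B (FN \<omega>) (G \<omega> - GN \<omega>))"
    using bigO_bilinear[OF B expands_partial_sum[OF F, of N] expands_remainder[OF G, of N]]
    by (simp add: FN_def GN_def)
  moreover have "bigO (Suc N) (\<lambda>\<omega>. sum (T \<omega>) {(r, s). r \<le> N \<and> s \<le> N \<and> N < r + s})"
  proof (rule bigO_sum, clarsimp simp: T_def)
    fix r s assume "N < r + s"
    have "bigO (r + s + (0 + 0)) (\<lambda>\<omega>. stp \<omega> ^ (r + s) *\<^sub>R B (e r \<omega>) (f s \<omega>))"
      by (intro bigO_scaleR bigO_stp bigO_bilinear[OF B] expands_coeff[OF F] expands_coeff[OF G])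
    then show "bigO (Suc N) (\<lambda>\<omega>. stp \<omega> ^ (r + s) *\<^sub>R B (e r \<omega>) (f s \<omega>))"
      by (rule bigO_mono) (use \<open>N < r + s\<close> in auto)
  qed
  ultimately show "bigO (Suc N) (\<lambda>\<omega>. B (F \<omega>) (G \<omega>) -
      (\<Sum>r\<le>N. stp \<omega> ^ r *\<^sub>R (\<Sum>s\<le>r. B (e s \<omega>) (f (r - s) \<omega>))))"
    by (auto intro!: bigO_add)
qed

lemma expands_cong:
  assumes "uev (\<lambda>\<omega>. F \<omega> = G \<omega>)" "expands F e"
  shows "expands G e"
proof -
  have "bigO (Suc N) (\<lambda>\<omega>. G \<omega> - (\<Sum>r\<le>N. stp \<omega> ^ r *\<^sub>R e r \<omega>))" for N
    by (rule bigO_cong[OF _ expands_remainder[OF assms(2), of N]])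
       (rule uev_mono[OF assms(1)], simp)
  then show ?thesis using assms(2) by (simp add: expands_def)
qed

lemma expands_shift: "expands F e \<Longrightarrow> expands (\<lambda>\<omega>. F (shift \<omega>)) (\<lambda>r \<omega>. e r (shift \<omega>))"
  unfolding expands_def using bigO_shift by fastforce

text \<open>The k-th term starts at order k, so only finitely many terms contribute to a given power
  of h. Composition with a power series is thereby reduced to powers of the inner expansion.\<close>

lemma expands_series:
  fixes F :: "cfg \<Rightarrow> 'v::real_normed_vector"
  assumes Fk: "\<And>k. expands (Fk k) (e k)" and zero: "\<And>k r. r < k \<Longrightarrow> e k r = (\<lambda>\<omega>. 0)"
    and F: "\<And>N. bigO (Suc N) (\<lambda>\<omega>. F \<omega> - (\<Sum>k\<le>N. Fk k \<omega>))"
  shows "expands F (\<lambda>r \<omega>. \<Sum>k\<le>r. e k r \<omega>)"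
  unfolding expands_def
proof (intro conjI allI)
  show "bigO 0 (\<lambda>\<omega>. \<Sum>k\<le>r. e k r \<omega>)" for r using Fk by (intro bigO_sum expands_coeff)
  fix N
  have "(\<Sum>r\<le>N. stp \<omega> ^ r *\<^sub>R (\<Sum>k\<le>r. e k r \<omega>)) = (\<Sum>k\<le>N. \<Sum>r\<le>N. stp \<omega> ^ r *\<^sub>R e k r \<omega>)" for \<omega>
  proof -
    have "(\<Sum>k\<le>r. e k r \<omega>) = (\<Sum>k\<le>N. e k r \<omega>)" if "r \<le> N" for r
      using that zero by (intro sum.mono_neutral_left) auto
    then have "(\<Sum>r\<le>N. stp \<omega> ^ r *\<^sub>R (\<Sum>k\<le>r. e k r \<omega>)) = (\<Sum>r\<le>N. \<Sum>k\<le>N. stp \<omega> ^ r *\<^sub>R e k r \<omega>)"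
      by (simp add: scaleR_sum_right)
    then show ?thesis by (simp only:) (rule sum.swap)
  qed
  then have "F \<omega> - (\<Sum>r\<le>N. stp \<omega> ^ r *\<^sub>R (\<Sum>k\<le>r. e k r \<omega>)) = (F \<omega> - (\<Sum>k\<le>N. Fk k \<omega>))
     + (\<Sum>k\<le>N. Fk k \<omega> - (\<Sum>r\<le>N. stp \<omega> ^ r *\<^sub>R e k r \<omega>))" for \<omega>
    by (simp add: sum_subtractf)
  then show "bigO (Suc N) (\<lambda>\<omega>. F \<omega> - (\<Sum>r\<le>N. stp \<omega> ^ r *\<^sub>R (\<Sum>k\<le>r. e k r \<omega>)))"
    using F Fk by (simp only:) (intro bigO_add bigO_sum expands_remainder)
qed

section \<open>The filtered algebra of universal coefficients\<close>

text \<open>The degree bound is strict so that n = 0 describes the zero polynomial. With truncated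
  subtraction, \<open>Suc r - d\<close> then says degree at most r - d, and vanishing when r <
  d.\<close>

definition poly_lt :: "'v::real_vector set \<Rightarrow> nat \<Rightarrow> (real \<Rightarrow> 'v) \<Rightarrow> bool" where
  "poly_lt V n f \<longleftrightarrow> (\<exists>c. (\<forall>k<n. c k \<in> V) \<and> (\<forall>x. f x = (\<Sum>k<n. x ^ k *\<^sub>R c k)))"

lemma poly_lt_0 [simp]: "poly_lt V 0 f \<longleftrightarrow> f = (\<lambda>x. 0)"
  by (auto simp: poly_lt_def)

lemma poly_lt_zero: "subspace V \<Longrightarrow> poly_lt V n (\<lambda>x. 0)"
  unfolding poly_lt_def by (rule exI[of _ "\<lambda>k. 0"]) (simp add: subspace_0)

lemma poly_lt_monom: "subspace V \<Longrightarrow> v \<in> V \<Longrightarrow> k < n \<Longrightarrow> poly_lt V n (\<lambda>x. x ^ k *\<^sub>R v)"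
  unfolding poly_lt_def
  by (rule exI[of _ "\<lambda>l. if l = k then v else 0"])
     (auto simp: subspace_0 if_distrib[of "\<lambda>y. _ *\<^sub>R y"] cong: if_cong)

lemma poly_lt_add:
  assumes "subspace V" "poly_lt V n f" "poly_lt V n g"
  shows "poly_lt V n (\<lambda>x. f x + g x)"
proof -
  obtain c d where "\<forall>k<n. c k \<in> V" "\<forall>x. f x = (\<Sum>k<n. x ^ k *\<^sub>R c k)"
    "\<forall>k<n. d k \<in> V" "\<forall>x. g x = (\<Sum>k<n. x ^ k *\<^sub>R d k)"
    using assms unfolding poly_lt_def by blast
  then show ?thesis unfolding poly_lt_def
    by (intro exI[of _ "\<lambda>k. c k + d k"]) (simp add: subspace_add[OF assms(1)] scaleR_add_right sum.distrib)
qed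

lemma poly_lt_sum:
  "subspace V \<Longrightarrow> (\<And>i. i \<in> A \<Longrightarrow> poly_lt V n (f i)) \<Longrightarrow> poly_lt V n (\<lambda>x. \<Sum>i\<in>A. f i x)"
  by (induction A rule: infinite_finite_induct) (auto intro: poly_lt_add poly_lt_zero)

lemma poly_lt_linear:
  assumes "linear T" "T ` V \<subseteq> V'" "poly_lt V n f"
  shows "poly_lt V' n (\<lambda>x. T (f x))"
proof -
  interpret linear T by fact
  obtain c where "\<forall>k<n. c k \<in> V" "\<forall>x. f x = (\<Sum>k<n. x ^ k *\<^sub>R c k)"
    using assms unfolding poly_lt_def by blast
  then show ?thesis using assms(2) unfolding poly_lt_def
    by (intro exI[of _ "\<lambda>k. T (c k)"]) (auto simp: sum scale)
qed

lemma poly_lt_mono: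
  assumes "subspace V" "poly_lt V n f" "n \<le> m"
  shows "poly_lt V m f"
proof -
  obtain c where c: "\<forall>k<n. c k \<in> V" "\<forall>x. f x = (\<Sum>k<n. x ^ k *\<^sub>R c k)"
    using assms unfolding poly_lt_def by blast
  have "poly_lt V m (\<lambda>x. \<Sum>k<n. x ^ k *\<^sub>R c k)"
    using c(1) assms by (intro poly_lt_sum poly_lt_monom) auto
  moreover have "f = (\<lambda>x. \<Sum>k<n. x ^ k *\<^sub>R c k)" using c(2) by auto
  ultimately show ?thesis by simp
qed

lemma poly_lt_bilinear:
  assumes B: "bounded_bilinear B" and V: "\<And>u v. u \<in> V1 \<Longrightarrow> v \<in> V2 \<Longrightarrow> B u v \<in> V3" "subspace V3"
    and f: "poly_lt V1 m f" and g: "poly_lt V2 n g"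
  shows "poly_lt V3 (m + n - 1) (\<lambda>x. B (f x) (g x))"
proof -
  interpret bounded_bilinear B by fact
  obtain c where c: "\<forall>k<m. c k \<in> V1" "\<forall>x. f x = (\<Sum>k<m. x ^ k *\<^sub>R c k)"
    using f unfolding poly_lt_def by blast
  obtain d where d: "\<forall>k<n. d k \<in> V2" "\<forall>x. g x = (\<Sum>k<n. x ^ k *\<^sub>R d k)"
    using g unfolding poly_lt_def by blast
  have "poly_lt V3 (m + n - 1) (\<lambda>x. \<Sum>k<m. \<Sum>l<n. x ^ (k + l) *\<^sub>R B (c k) (d l))"
    using c d V by (intro poly_lt_sum poly_lt_monom) auto
  moreover have "B (f x) (g x) = (\<Sum>k<m. \<Sum>l<n. x ^ (k + l) *\<^sub>R B (c k) (d l))" for x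
    unfolding c(2)[rule_format] d(2)[rule_format] sum_left sum_right
    by (subst sum.swap) (simp add: scaleR_left scaleR_right power_add mult.commute)
  ultimately show ?thesis by simp
qed

lemma poly_lt_times:
  assumes "subspace V" "poly_lt V n f"
  shows "poly_lt V (Suc n) (\<lambda>x. x *\<^sub>R f x)"
proof -
  obtain c where c: "\<forall>k<n. c k \<in> V" "\<forall>x. f x = (\<Sum>k<n. x ^ k *\<^sub>R c k)"
    using assms unfolding poly_lt_def by blast
  have "poly_lt V (Suc n) (\<lambda>x. \<Sum>k<n. x ^ Suc k *\<^sub>R c k)"
    using c(1) assms by (intro poly_lt_sum poly_lt_monom) auto
  then show ?thesis using c(2) by (simp add: scaleR_sum_right)
qed

text \<open>In the binomial expansion of (x - 1)^k - x^k the top term cancels, which leaves the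
  exponents l < k.\<close>

lemma poly_lt_difference:
  assumes "subspace V" "poly_lt V n f"
  shows "poly_lt V (n - 1) (\<lambda>x. f (x - 1) - f x)"
proof -
  obtain c where c: "\<forall>k<n. c k \<in> V" "\<forall>x. f x = (\<Sum>k<n. x ^ k *\<^sub>R c k)"
    using assms unfolding poly_lt_def by blast
  have *: "(x - 1) ^ k - x ^ k = (\<Sum>l<k. of_nat (k choose l) * x ^ l * (-1) ^ (k - l))" for x :: real and k
    using binomial_ring[of x "-1" k] by (simp add: lessThan_Suc_atMost[symmetric])
  have "f (x - 1) - f x = (\<Sum>k<n. \<Sum>l<k. x ^ l *\<^sub>R ((of_nat (k choose l) * (-1) ^ (k - l)) *\<^sub>R c k))" for x
  proof -
    have "f (x - 1) - f x = (\<Sum>k<n. ((x - 1) ^ k - x ^ k) *\<^sub>R c k)"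
      using c(2) by (simp add: sum_subtractf scaleR_diff_left)
    then show ?thesis unfolding * by (simp add: scaleR_sum_left mult_ac)
  qed
  moreover have "poly_lt V (n - 1) (\<lambda>x. \<Sum>k<n. \<Sum>l<k. x ^ l *\<^sub>R ((of_nat (k choose l) * (-1) ^ (k - l)) *\<^sub>R c k))"
    using c assms(1) by (intro poly_lt_sum poly_lt_monom) (auto intro: subspace_scale)
  ultimately show ?thesis by simp
qed

section \<open>Universal coefficient maps, their order and their defect\<close>

definition jet :: "cfg \<Rightarrow> nat \<Rightarrow> real^3" where
  "jet \<omega> k = iter_deriv k (\<lambda>\<eta>. Log_S2 (crv \<omega> (tm \<omega>)) (crv \<omega> (tm \<omega> + \<eta>))) 0"

lemma jet_shift [simp]: "jet (shift \<omega>) = jet \<omega>"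
  by (simp add: jet_def fun_eq_iff)

type_synonym 'v coeffs = "nat \<Rightarrow> (nat \<Rightarrow> real^3) \<Rightarrow> real \<Rightarrow> 'v"

text \<open>Arguments of \<open>coeffs\<close>: power of \<open>h\<close>, jet, \<open>\<xi>\<close>. In \<open>universal W m d c\<close> and
  \<open>filtered W m d F\<close>, the order of vanishing in \<open>h\<close> is at least \<open>m\<close>, the defect is \<open>d\<close>, and
  \<open>W\<close> gives the subspace in which the coefficients lie for a given jet.\<close>

definition universal :: "((nat \<Rightarrow> real^3) \<Rightarrow> 'v::real_vector set) \<Rightarrow> nat \<Rightarrow> nat \<Rightarrow> 'v coeffs \<Rightarrow> bool" where
  "universal W m d c \<longleftrightarrow> (\<forall>j. subspace (W j)) \<and> (\<forall>r j. poly_lt (W j) (Suc r - d) (c r j)) \<and>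
     (\<forall>r<m. \<forall>j. c r j = (\<lambda>x. 0)) \<and> (\<forall>r j j'. (\<forall>k\<le>r. j k = j' k) \<longrightarrow> c r j = c r j')"

definition filtered ::
  "((nat \<Rightarrow> real^3) \<Rightarrow> 'v::real_normed_vector set) \<Rightarrow> nat \<Rightarrow> nat \<Rightarrow> (cfg \<Rightarrow> 'v) \<Rightarrow> bool" where
  "filtered W m d F \<longleftrightarrow> (\<exists>c. universal W m d c \<and> expands F (\<lambda>r \<omega>. c r (jet \<omega>) (xi \<omega>)))"

lemma filteredE:
  assumes "filtered W m d F"
  obtains c where "universal W m d c" "expands F (\<lambda>r \<omega>. c r (jet \<omega>) (xi \<omega>))"
  using assms unfolding filtered_def by blast

lemma universalD:
  assumes "universal W m d c"
  shows "subspace (W j)" "poly_lt (W j) (Suc r - d) (c r j)" "r < m \<Longrightarrow> c r j = (\<lambda>x. 0)"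
    "(\<And>k. k \<le> r \<Longrightarrow> j k = j' k) \<Longrightarrow> c r j = c r j'"
  using assms unfolding universal_def by blast+

lemma universalI:
  assumes "\<And>j. subspace (W j)" "\<And>r j. poly_lt (W j) (Suc r - d) (c r j)" "\<And>r j. r < m \<Longrightarrow> c r j = (\<lambda>x. 0)"
    "\<And>r j j'. (\<And>k. k \<le> r \<Longrightarrow> j k = j' k) \<Longrightarrow> c r j = c r j'"
  shows "universal W m d c"
  using assms unfolding universal_def by blast

lemma filtered_subspace: "filtered W m d F \<Longrightarrow> subspace (W j)"
  by (auto elim!: filteredE dest: universalD)

lemma filtered_cong: "uev (\<lambda>\<omega>. F \<omega> = G \<omega>) \<Longrightarrow> filtered W m d F \<Longrightarrow> filtered W m d G"
  unfolding filtered_def using expands_cong by blast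

lemma filtered_mono:
  assumes "filtered W m d F" "m' \<le> m" "d' \<le> d"
  shows "filtered W m' d' F"
proof -
  obtain c where c: "universal W m d c" and e: "expands F (\<lambda>r \<omega>. c r (jet \<omega>) (xi \<omega>))"
    using assms(1) by (rule filteredE)
  have "universal W m' d' c"
  proof (rule universalI)
    show "poly_lt (W j) (Suc r - d') (c r j)" for r j
      using poly_lt_mono[OF universalD(1,2)[OF c]] assms(3) by (simp add: diff_le_mono2)
  qed (use universalD(1,3)[OF c] assms(2) in \<open>auto intro: universalD(4)[OF c]\<close>)
  with e show ?thesis unfolding filtered_def by blast
qed

text \<open>For r < d the degree bound is negative and the coefficient of h^r vanishes. Defect d
  therefore forces order d, which is how smallness of differences is obtained from their
  defect.\<close>

lemma filtered_order:
  assumes "filtered W m d F"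
  shows "filtered W (max m d) d F"
proof -
  obtain c where c: "universal W m d c" and e: "expands F (\<lambda>r \<omega>. c r (jet \<omega>) (xi \<omega>))"
    using assms(1) by (rule filteredE)
  have "universal W (max m d) d c"
  proof (rule universalI)
    fix r j assume "r < max m d"
    then consider "r < m" | "Suc r - d = 0" by linarith
    then show "c r j = (\<lambda>x. 0)" using universalD(2)[OF c, of j r] universalD(3)[OF c] by cases auto
  qed (use universalD(1,2)[OF c] in \<open>auto intro: universalD(4)[OF c]\<close>)
  with e show ?thesis unfolding filtered_def by blast
qed

lemma filtered_bigO:
  assumes "filtered W m d F"
  shows "bigO m F"
proof -
  obtain c where c: "universal W m d c" and e: "expands F (\<lambda>r \<omega>. c r (jet \<omega>) (xi \<omega>))"
    using assms(1) by (rule filteredE)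
  show ?thesis by (rule expands_bigO[OF e]) (simp add: universalD(3)[OF c])
qed

lemma filtered_add:
  assumes "filtered W m d F" "filtered W m d G"
  shows "filtered W m d (\<lambda>\<omega>. F \<omega> + G \<omega>)"
proof -
  obtain c where c: "universal W m d c" "expands F (\<lambda>r \<omega>. c r (jet \<omega>) (xi \<omega>))"
    using assms(1) by (rule filteredE)
  obtain c' where c': "universal W m d c'" "expands G (\<lambda>r \<omega>. c' r (jet \<omega>) (xi \<omega>))"
    using assms(2) by (rule filteredE)
  have "universal W m d (\<lambda>r j x. c r j x + c' r j x)"
  proof (rule universalI)
    show "(\<lambda>x. c r j x + c' r j x) = (\<lambda>x. c r j' x + c' r j' x)" if "\<And>k. k \<le> r \<Longrightarrow> j k = j' k" for r j j'
      using universalD(4)[OF c(1), of r j j'] universalD(4)[OF c'(1), of r j j'] that by simp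
  qed (use universalD(1-3)[OF c(1)] universalD(1-3)[OF c'(1)] in \<open>auto intro: poly_lt_add\<close>)
  then show ?thesis unfolding filtered_def using expands_add[OF c(2) c'(2)] by blast
qed

lemma filtered_linear:
  assumes "bounded_linear T" "\<And>j. T ` W j \<subseteq> W' j" "\<And>j. subspace (W' j)" "filtered W m d F"
  shows "filtered W' m d (\<lambda>\<omega>. T (F \<omega>))"
proof -
  obtain c where c: "universal W m d c" "expands F (\<lambda>r \<omega>. c r (jet \<omega>) (xi \<omega>))"
    using assms(4) by (rule filteredE)
  have "universal W' m d (\<lambda>r j x. T (c r j x))"
  proof (rule universalI)
    show "(\<lambda>x. T (c r j x)) = (\<lambda>x. T (c r j' x))" if "\<And>k. k \<le> r \<Longrightarrow> j k = j' k" for r j j'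
      using universalD(4)[OF c(1), of r j j'] that by simp
    show "poly_lt (W' j) (Suc r - d) (\<lambda>x. T (c r j x))" for r j
      by (rule poly_lt_linear[OF bounded_linear.linear[OF assms(1)] assms(2) universalD(2)[OF c(1)]])
  qed (use universalD(3)[OF c(1)] assms(3) bounded_linear.linear[OF assms(1)] in \<open>auto simp: linear_0\<close>)
  then show ?thesis unfolding filtered_def using expands_linear[OF assms(1) c(2)] by blast
qed

lemma filtered_scale: "filtered W m d F \<Longrightarrow> filtered W m d (\<lambda>\<omega>. s *\<^sub>R F \<omega>)"
  by (rule filtered_linear[OF bounded_linear_scaleR_right])
     (auto intro: filtered_subspace subspace_scale)

lemma filtered_diff: "filtered W m d F \<Longrightarrow> filtered W m d G \<Longrightarrow> filtered W m d (\<lambda>\<omega>. F \<omega> - G \<omega>)"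
  using filtered_add[of W m d F "\<lambda>\<omega>. (-1) *\<^sub>R G \<omega>"] filtered_scale[of W m d G "-1"] by simp

text \<open>Each term of the Cauchy product has degree at most (s - d) + (r - s - d') = r - (d +
  d').\<close>

lemma filtered_bilinear:
  assumes B: "bounded_bilinear B"
    and W: "\<And>j u v. u \<in> W1 j \<Longrightarrow> v \<in> W2 j \<Longrightarrow> B u v \<in> W3 j" "\<And>j. subspace (W3 j)"
    and "filtered W1 m d F" "filtered W2 m' d' G"
  shows "filtered W3 (m + m') (d + d') (\<lambda>\<omega>. B (F \<omega>) (G \<omega>))"
proof -
  interpret bounded_bilinear B by fact
  obtain c where c: "universal W1 m d c" "expands F (\<lambda>r \<omega>. c r (jet \<omega>) (xi \<omega>))"
    using assms(4) by (rule filteredE)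
  obtain c' where c': "universal W2 m' d' c'" "expands G (\<lambda>r \<omega>. c' r (jet \<omega>) (xi \<omega>))"
    using assms(5) by (rule filteredE)
  have "universal W3 (m + m') (d + d') (\<lambda>r j x. \<Sum>s\<le>r. B (c s j x) (c' (r - s) j x))"
  proof (rule universalI)
    show "poly_lt (W3 j) (Suc r - (d + d')) (\<lambda>x. \<Sum>s\<le>r. B (c s j x) (c' (r - s) j x))" for r j
    proof (rule poly_lt_sum[OF W(2)])
      fix s assume "s \<in> {..r}"
      have p: "poly_lt (W1 j) (Suc s - d) (c s j)" "poly_lt (W2 j) (Suc (r - s) - d') (c' (r - s) j)"
        using universalD(2)[OF c(1)] universalD(2)[OF c'(1)] by blast+
      show "poly_lt (W3 j) (Suc r - (d + d')) (\<lambda>x. B (c s j x) (c' (r - s) j x))"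
      \<comment> \<open>If one of the two bounds is cut off at 0, the bounds no longer add up as
        integers do; the corresponding factor is then zero.\<close>
      proof (cases "Suc s - d = 0 \<or> Suc (r - s) - d' = 0")
        case True
        then have "(\<lambda>x. B (c s j x) (c' (r - s) j x)) = (\<lambda>x. 0)"
          using p by (elim disjE) (simp_all only: poly_lt_0 zero_left zero_right)
        then show ?thesis by (simp add: poly_lt_zero W(2))
      next
        case False
        then have "Suc s - d + (Suc (r - s) - d') - 1 \<le> Suc r - (d + d')"
          using \<open>s \<in> {..r}\<close> by auto
        then show ?thesis
          using poly_lt_mono[OF W(2) poly_lt_bilinear[OF B _ W(2) p]] W(1) by blast
      qed
    qed
    show "(\<lambda>x. \<Sum>s\<le>r. B (c s j x) (c' (r - s) j x)) = (\<lambda>x. 0)" if "r < m + m'" for r j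
    proof
      fix x
      show "(\<Sum>s\<le>r. B (c s j x) (c' (r - s) j x)) = 0"
      proof (rule sum.neutral, rule ballI)
        fix s assume "s \<in> {..r}"
        with that consider "s < m" | "r - s < m'" by force
        then show "B (c s j x) (c' (r - s) j x) = 0"
          using universalD(3)[OF c(1)] universalD(3)[OF c'(1)] by cases (auto simp: zero_left zero_right)
      qed
    qed
    show "(\<lambda>x. \<Sum>s\<le>r. B (c s j x) (c' (r - s) j x)) = (\<lambda>x. \<Sum>s\<le>r. B (c s j' x) (c' (r - s) j' x))"
      if j: "\<And>k. k \<le> r \<Longrightarrow> j k = j' k" for r j j'
    proof -
      have "c s j = c s j'" "c' (r - s) j = c' (r - s) j'" if "s \<le> r" for s
        using universalD(4)[OF c(1), of s j j'] universalD(4)[OF c'(1), of "r - s" j j'] j that by auto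
      then show ?thesis by simp
    qed
  qed (rule W(2))
  then show ?thesis unfolding filtered_def using expands_bilinear[OF B c(2) c'(2)] by blast
qed

text \<open>The degree rises by one at the same power of h. The remainder keeps its order since
  \<xi> is bounded on every window.\<close>

lemma filtered_xi:
  assumes "filtered W m (Suc d) F"
  shows "filtered W m d (\<lambda>\<omega>. xi \<omega> *\<^sub>R F \<omega>)"
proof -
  obtain c where c: "universal W m (Suc d) c" "expands F (\<lambda>r \<omega>. c r (jet \<omega>) (xi \<omega>))"
    using assms(1) by (rule filteredE)
  have "universal W m d (\<lambda>r j x. x *\<^sub>R c r j x)"
  proof (rule universalI)
    show "poly_lt (W j) (Suc r - d) (\<lambda>x. x *\<^sub>R c r j x)" for r j
    proof (cases "d \<le> r")
      case True
      then show ?thesis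
        using poly_lt_times[OF universalD(1)[OF c(1), of j] universalD(2)[OF c(1), of j r]] by (simp add: Suc_diff_le)
    next
      case False
      then show ?thesis using universalD(2)[OF c(1), of j r] by (simp add: poly_lt_zero universalD(1)[OF c(1)])
    qed
    show "(\<lambda>x. x *\<^sub>R c r j x) = (\<lambda>x. x *\<^sub>R c r j' x)" if "\<And>k. k \<le> r \<Longrightarrow> j k = j' k" for r j j'
      using universalD(4)[OF c(1), of r j j'] that by simp
  qed (use universalD(1,3)[OF c(1)] in auto)
  moreover have "expands (\<lambda>\<omega>. xi \<omega> *\<^sub>R F \<omega>) (\<lambda>r \<omega>. xi \<omega> *\<^sub>R c r (jet \<omega>) (xi \<omega>))"
    unfolding expands_def
  proof (intro conjI allI)
    show "bigO 0 (\<lambda>\<omega>. xi \<omega> *\<^sub>R c r (jet \<omega>) (xi \<omega>))" for r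
      using bigO_scaleR[OF bigO_xi expands_coeff[OF c(2)]] by simp
    show "bigO (Suc N) (\<lambda>\<omega>. xi \<omega> *\<^sub>R F \<omega> - (\<Sum>r\<le>N. stp \<omega> ^ r *\<^sub>R xi \<omega> *\<^sub>R c r (jet \<omega>) (xi \<omega>)))" for N
      using bigO_scaleR[OF bigO_xi expands_remainder[OF c(2), of N]]
      by (simp add: scaleR_diff_right scaleR_sum_right mult.commute)
  qed
  ultimately show ?thesis unfolding filtered_def by blast
qed

lemma filtered_const:
  assumes "\<And>j. subspace (W j)" "\<And>j. v \<in> W j"
  shows "filtered W 0 0 (\<lambda>\<omega>. v)"
proof -
  have "universal W 0 0 (\<lambda>r j x. if r = 0 then v else 0)"
  proof (rule universalI)
    show "poly_lt (W j) (Suc r - 0) (\<lambda>x. if r = 0 then v else 0)" for r j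
      using poly_lt_monom[OF assms, of 0 "Suc r" j] poly_lt_zero[OF assms(1)]
      by (cases "r = 0") simp_all
  qed (use assms in auto)
  moreover have "expands (\<lambda>\<omega>. v) (\<lambda>r \<omega>. if r = 0 then v else 0)"
    unfolding expands_def
    by (auto simp: bigO_const if_distrib[of "\<lambda>y. _ *\<^sub>R y"] cong: if_cong)
  ultimately show ?thesis unfolding filtered_def by blast
qed

lemma filtered_zero:
  assumes "\<And>j. subspace (W j)"
  shows "filtered W m d (\<lambda>\<omega>. 0)"
proof -
  have "universal W m d (\<lambda>r j x. 0)"
    using assms by (intro universalI) (auto intro: poly_lt_zero)
  moreover have "expands (\<lambda>\<omega>. 0) (\<lambda>r \<omega>. 0)" unfolding expands_def by auto
  ultimately show ?thesis unfolding filtered_def by blast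
qed

text \<open>The exact point and hence the jet are unchanged by the shift, and the coefficient maps
  are the same for both stencils. Coefficientwise the difference is thus a finite difference of one
  polynomial in \<xi>.\<close>

lemma filtered_shift_difference:
  assumes "filtered W m d F"
  shows "filtered W m (Suc d) (\<lambda>\<omega>. F (shift \<omega>) - F \<omega>)"
proof -
  obtain c where c: "universal W m d c" "expands F (\<lambda>r \<omega>. c r (jet \<omega>) (xi \<omega>))"
    using assms(1) by (rule filteredE)
  have "universal W m (Suc d) (\<lambda>r j x. c r j (x - 1) - c r j x)"
  proof (rule universalI)
    show "poly_lt (W j) (Suc r - Suc d) (\<lambda>x. c r j (x - 1) - c r j x)" for r j
      using poly_lt_difference[OF universalD(1)[OF c(1), of j] universalD(2)[OF c(1), of j r]] by simp
    show "(\<lambda>x. c r j (x - 1) - c r j x) = (\<lambda>x. c r j' (x - 1) - c r j' x)"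
      if "\<And>k. k \<le> r \<Longrightarrow> j k = j' k" for r j j'
      using universalD(4)[OF c(1), of r j j'] that by simp
  qed (use universalD(1,3)[OF c(1)] in auto)
  moreover have "expands (\<lambda>\<omega>. F (shift \<omega>) - F \<omega>)
      (\<lambda>r \<omega>. c r (jet \<omega>) (xi \<omega> - 1) - c r (jet \<omega>) (xi \<omega>))"
    using expands_add[OF expands_shift[OF c(2)] expands_linear[OF bounded_linear_minus[OF bounded_linear_ident] c(2)]]
    by simp
  ultimately show ?thesis unfolding filtered_def by blast
qed

text \<open>The maximum combines two demands on the k-th term: order k makes the coefficient sums
  finite, order m is handed on to the limit.\<close>

lemma filtered_series:
  assumes Fk: "\<And>k. filtered W (max m k) d (Fk k)"
    and F: "\<And>N. bigO (Suc N) (\<lambda>\<omega>. F \<omega> - (\<Sum>k\<le>N. Fk k \<omega>))"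
  shows "filtered W m d F"
proof -
  have "\<forall>k. \<exists>c. universal W (max m k) d c \<and> expands (Fk k) (\<lambda>r \<omega>. c r (jet \<omega>) (xi \<omega>))"
    using Fk unfolding filtered_def by blast
  then obtain c where c: "\<And>k. universal W (max m k) d (c k)"
    "\<And>k. expands (Fk k) (\<lambda>r \<omega>. c k r (jet \<omega>) (xi \<omega>))" by metis
  have "universal W m d (\<lambda>r j x. \<Sum>k\<le>r. c k r j x)"
  proof (rule universalI)
    show "poly_lt (W j) (Suc r - d) (\<lambda>x. \<Sum>k\<le>r. c k r j x)" for r j
      by (intro poly_lt_sum universalD(1,2)[OF c(1)])
    show "(\<lambda>x. \<Sum>k\<le>r. c k r j x) = (\<lambda>x. \<Sum>k\<le>r. c k r j' x)" if "\<And>k. k \<le> r \<Longrightarrow> j k = j' k" for r j j'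
      using universalD(4)[OF c(1), of r j j'] that by simp
  qed (use universalD(1,3)[OF c(1)] in auto)
  moreover have "expands F (\<lambda>r \<omega>. \<Sum>k\<le>r. c k r (jet \<omega>) (xi \<omega>))"
    by (rule expands_series[OF c(2) _ F]) (use universalD(3)[OF c(1)] in auto)
  ultimately show ?thesis unfolding filtered_def by blast
qed

section \<open>Power series and spherical geometry\<close>

definition psum :: "(nat \<Rightarrow> real) \<Rightarrow> real \<Rightarrow> real" where
  "psum a x = (\<Sum>n. a n * x ^ n)"

text \<open>Radius one is shared by the three series below. Bounds are derived on |x| \<le> 1/2
  only, a fixed margin inside.\<close>

definition unit_radius :: "(nat \<Rightarrow> real) \<Rightarrow> bool" where
  "unit_radius a \<longleftrightarrow> (\<forall>x. \<bar>x\<bar> < 1 \<longrightarrow> summable (\<lambda>n. a n * x ^ n))"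

lemma unit_radius_bounded:
  assumes "\<And>n. \<bar>a n\<bar> \<le> 1"
  shows "unit_radius a"
  unfolding unit_radius_def
proof (intro allI impI)
  fix x :: real assume "\<bar>x\<bar> < 1"
  then have "summable (\<lambda>n. \<bar>x\<bar> ^ n)" by (intro summable_geometric) simp
  moreover have "norm (a n * x ^ n) \<le> \<bar>x\<bar> ^ n" for n
    using mult_right_mono[OF assms, of "\<bar>x\<bar> ^ n" n] by (simp add: abs_mult power_abs)
  ultimately show "summable (\<lambda>n. a n * x ^ n)"
    by (rule summable_comparison_test'[where N = 0])
qed

lemma unit_radius_diffs: "unit_radius a \<Longrightarrow> unit_radius (diffs a)"
  unfolding unit_radius_def by (metis termdiff_converges real_norm_def)

lemma psum_deriv:
  assumes "unit_radius a" "\<bar>x\<bar> < 1"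
  shows "(psum a has_field_derivative psum (diffs a) x) (at x)"
  unfolding psum_def[abs_def]
  by (rule termdiffs_strong'[of 1]) (use assms in \<open>auto simp: unit_radius_def\<close>)

lemma psum_sums: "unit_radius a \<Longrightarrow> \<bar>x\<bar> < 1 \<Longrightarrow> (\<lambda>n. a n * x ^ n) sums psum a x"
  unfolding psum_def unit_radius_def by (rule summable_sums) auto

lemma psum_bounded:
  assumes "unit_radius a"
  obtains B where "\<And>x. \<bar>x\<bar> \<le> 1/2 \<Longrightarrow> \<bar>psum a x\<bar> \<le> B"
proof -
  have "continuous_on {-1/2..1/2} (psum a)"
  proof (rule continuous_at_imp_continuous_on, rule ballI)
    fix x :: real assume "x \<in> {-1/2..1/2}"
    then have "\<bar>x\<bar> < 1" by auto
    then show "isCont (psum a) x" by (rule DERIV_isCont[OF psum_deriv[OF assms]])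
  qed
  then have "bounded (psum a ` {-1/2..1/2})"
    by (intro compact_imp_bounded compact_continuous_image) auto
  then obtain B where B: "\<forall>y\<in>psum a ` {-1/2..1/2}. norm y \<le> B" unfolding bounded_iff by blast
  show ?thesis
  proof (rule that)
    fix x :: real assume "\<bar>x\<bar> \<le> 1/2"
    then have "x \<in> {-1/2..1/2}" by auto
    with B show "\<bar>psum a x\<bar> \<le> B" by auto
  qed
qed

lemma unit_radius_shift:
  assumes "unit_radius a"
  shows "unit_radius (\<lambda>n. a (n + N))"
  unfolding unit_radius_def
proof (intro allI impI)
  fix x :: real assume x: "\<bar>x\<bar> < 1"
  show "summable (\<lambda>n. a (n + N) * x ^ n)"
  proof (cases "x = 0")
    case False
    have "summable (\<lambda>n. a (n + N) * x ^ (n + N))"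
      using assms x unfolding unit_radius_def by (subst summable_iff_shift[of "\<lambda>n. a n * x ^ n"]) auto
    then have "summable (\<lambda>n. (a (n + N) * x ^ (n + N)) * inverse (x ^ N))" by (rule summable_mult2)
    then show ?thesis using False by (simp add: power_add field_simps)
  qed simp
qed

lemma psum_split:
  assumes "unit_radius a" "\<bar>x\<bar> < 1"
  shows "psum a x = (\<Sum>n<N. a n * x ^ n) + x ^ N * psum (\<lambda>n. a (n + N)) x"
proof -
  have s: "summable (\<lambda>n. a n * x ^ n)" "summable (\<lambda>n. a (n + N) * x ^ n)"
    using assms unit_radius_shift[OF assms(1), of N] by (auto simp: unit_radius_def)
  have "psum a x = (\<Sum>n. a (n + N) * x ^ (n + N)) + (\<Sum>n<N. a n * x ^ n)"
    unfolding psum_def by (rule suminf_split_initial_segment[OF s(1)])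
  also have "(\<Sum>n. a (n + N) * x ^ (n + N)) = x ^ N * psum (\<lambda>n. a (n + N)) x"
    unfolding psum_def using suminf_mult[OF s(2), of "x ^ N"] by (simp add: power_add mult_ac)
  finally show ?thesis by simp
qed

text \<open>The tail is \<open>x ^ Suc N\<close> times a power series of the same kind, which is
  bounded on a compact interval.\<close>

lemma psum_Taylor:
  assumes "unit_radius a"
  obtains C where "C \<ge> 0" "\<And>x. \<bar>x\<bar> \<le> 1/2 \<Longrightarrow> \<bar>psum a x - (\<Sum>n\<le>N. a n * x ^ n)\<bar> \<le> C * \<bar>x\<bar> ^ Suc N"
proof -
  obtain B where B: "\<And>x. \<bar>x\<bar> \<le> 1/2 \<Longrightarrow> \<bar>psum (\<lambda>n. a (n + Suc N)) x\<bar> \<le> B"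
    using psum_bounded[OF unit_radius_shift[OF assms, of "Suc N"]] by blast
  have "B \<ge> 0" using B[of 0] by simp
  moreover have "\<bar>psum a x - (\<Sum>n\<le>N. a n * x ^ n)\<bar> \<le> B * \<bar>x\<bar> ^ Suc N" if "\<bar>x\<bar> \<le> 1/2" for x
  proof -
    have "psum a x - (\<Sum>n\<le>N. a n * x ^ n) = x ^ Suc N * psum (\<lambda>n. a (n + Suc N)) x"
      using psum_split[OF assms, of x "Suc N"] that by (simp add: lessThan_Suc_atMost)
    then show ?thesis using mult_left_mono[OF B[OF that], of "\<bar>x\<bar> ^ Suc N"]
      by (simp add: abs_mult power_abs mult.commute)
  qed
  ultimately show ?thesis using that by blast
qed

text \<open>cos and sinc as functions of the square of their argument. \<open>gexp\<close> evaluates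
  them at \<open>v \<bullet> v\<close>, a polynomial in v, so the singularity of the norm at 0 does
  not enter.\<close>

definition cosq :: "nat \<Rightarrow> real" where "cosq n = (-1) ^ n / fact (2 * n)"
definition sincq :: "nat \<Rightarrow> real" where "sincq n = (-1) ^ n / fact (2 * n + 1)"

lemma unit_radius_cosq: "unit_radius cosq"
  by (rule unit_radius_bounded) (simp add: cosq_def abs_divide power_abs)

lemma unit_radius_sincq: "unit_radius sincq"
  by (rule unit_radius_bounded) (simp add: sincq_def abs_divide power_abs del: fact_Suc)

lemma psum_cosq: "psum cosq (x\<^sup>2) = cos x"
  using cos_paired[of x, THEN sums_unique] by (simp add: psum_def cosq_def power_mult)

lemma psum_sincq: "x * psum sincq (x\<^sup>2) = sin x"
proof (cases "x = 0")
  case False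
  have "(\<lambda>n. inverse x * ((- 1) ^ n / fact (2 * n + 1) * x ^ (2 * n + 1))) sums (inverse x * sin x)"
    by (rule sums_mult[OF sin_paired])
  also have "(\<lambda>n. inverse x * ((- 1) ^ n / fact (2 * n + 1) * x ^ (2 * n + 1))) = (\<lambda>n. sincq n * (x\<^sup>2) ^ n)"
    using False by (simp add: sincq_def power_mult fun_eq_iff del: fact_Suc)
  finally show ?thesis using False by (simp add: psum_def sums_iff)
qed simp

text \<open>\<open>psum angq x = \<alpha> / sin \<alpha>\<close> for \<open>x = 1 - cos \<alpha>\<close>; the recursion is the differential equation
  \<open>x (2 - x) y' = 1 - (1 - x) y\<close> of that function.\<close>

primrec angq :: "nat \<Rightarrow> real" where
  "angq 0 = 1"
| "angq (Suc n) = real (Suc n) / real (2 * n + 3) * angq n"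

lemma unit_radius_angq: "unit_radius angq"
proof (rule unit_radius_bounded)
  have "0 \<le> angq n \<and> angq n \<le> 1" for n
  proof (induction n)
    case (Suc n)
    have "real (Suc n) * angq n \<le> real (Suc n) * 1" using Suc by (intro mult_left_mono) auto
    also have "\<dots> \<le> 2 * real n + 3" by simp
    finally show ?case using Suc by simp
  qed simp
  then show "\<bar>angq n\<bar> \<le> 1" for n by (simp add: abs_of_nonneg)
qed

text \<open>Comparing coefficients would give the recursion of \<open>angq\<close>; the proof sums
  the recursion instead, as a telescoping series.\<close>

lemma psum_angq_ode:
  assumes "\<bar>x\<bar> < 1"
  shows "x * (2 - x) * psum (diffs angq) x = 1 - (1 - x) * psum angq x"
proof -
  define D where "D = psum (diffs angq) x"
  have sD: "(\<lambda>n. diffs angq n * x ^ n) sums D"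
    unfolding D_def by (rule psum_sums[OF unit_radius_diffs[OF unit_radius_angq] assms])
  have sA: "(\<lambda>n. angq n * x ^ n) sums psum angq x" by (rule psum_sums[OF unit_radius_angq assms])
  have sxD: "(\<lambda>n. real n * angq n * x ^ n) sums (x * D)"
  proof -
    have "(\<lambda>n. x * (diffs angq n * x ^ n)) sums (x * D)" by (rule sums_mult[OF sD])
    then have "(\<lambda>n. real (Suc n) * angq (Suc n) * x ^ Suc n) sums (x * D)"
      by (simp add: diffs_def mult_ac)
    then show ?thesis by (subst (asm) sums_Suc_iff) simp
  qed
  have "(\<lambda>n. 2 * (real n * angq n * x ^ n) + angq n * x ^ n - x * (real n * angq n * x ^ n) - x * (angq n * x ^ n))
      sums (2 * (x * D) + psum angq x - x * (x * D) - x * psum angq x)"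
    by (intro sums_diff sums_add sums_mult sxD sA)
  moreover have "(\<lambda>n. 2 * (real n * angq n * x ^ n) + angq n * x ^ n - x * (real n * angq n * x ^ n) - x * (angq n * x ^ n)) sums 1"
  proof -
    \<comment> \<open>By the recursion, (2n + 3) a(n+1) = (n + 1) a(n), so \<open>u (Suc n)\<close>
      equals the two subtracted terms of the series above. The sum telescopes to
      \<open>u 0 = 1\<close>.\<close>
    define u where "u n = (2 * real n + 1) * angq n * x ^ n" for n
    have Su: "u (Suc n) = x * (real n * angq n * x ^ n) + x * (angq n * x ^ n)" for n
      unfolding u_def by (simp add: field_simps)
    have lim: "u \<longlonglongrightarrow> 0"
    proof -
      have "(\<lambda>n. 2 * (real n * angq n * x ^ n) + angq n * x ^ n) \<longlonglongrightarrow> 2 * 0 + 0"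
        by (intro tendsto_add tendsto_mult tendsto_const summable_LIMSEQ_zero sums_summable[OF sxD] sums_summable[OF sA])
      then show ?thesis by (simp add: u_def[abs_def] algebra_simps)
    qed
    have "(\<lambda>n. u n - u (Suc n)) sums (u 0 - 0)" by (rule telescope_sums'[OF lim])
    moreover have "u n - u (Suc n) = 2 * (real n * angq n * x ^ n) + angq n * x ^ n - x * (real n * angq n * x ^ n) - x * (angq n * x ^ n)" for n
      unfolding Su unfolding u_def by (simp add: algebra_simps)
    ultimately show ?thesis by (simp add: u_def)
  qed
  ultimately have "2 * (x * D) + psum angq x - x * (x * D) - x * psum angq x = 1" by (rule sums_unique2)
  then show ?thesis by (simp add: D_def algebra_simps)
qed

text \<open>With x = 1 - cos t one has x (2 - x) = sin^2 t, so the differential equation makes the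
  difference of the two sides constant; it vanishes at 0. Below \<pi> / 2 the argument x stays less
  than 1.\<close>

lemma psum_angq:
  assumes "0 \<le> \<alpha>" "\<alpha> < pi / 2"
  shows "sin \<alpha> * psum angq (1 - cos \<alpha>) = \<alpha>"
proof -
  define f where "f t = t - sin t * psum angq (1 - cos t)" for t
  have D: "(f has_field_derivative 0) (at t)" if "0 \<le> t" "t < pi / 2" for t
  proof -
    have c: "0 < cos t" "cos t \<le> 1" using that by (auto intro: cos_gt_zero_pi)
    then have x: "\<bar>1 - cos t\<bar> < 1" by auto
    have d: "((\<lambda>t. psum angq (1 - cos t)) has_field_derivative psum (diffs angq) (1 - cos t) * sin t) (at t)"
      by (rule DERIV_chain2[where f = "psum angq" and g = "\<lambda>t. 1 - cos t", OF psum_deriv[OF unit_radius_angq x]]) (auto intro!: derivative_eq_intros)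
    have "(f has_field_derivative 1 - (cos t * psum angq (1 - cos t) + psum (diffs angq) (1 - cos t) * sin t * sin t)) (at t)"
      unfolding f_def by (intro DERIV_diff DERIV_ident DERIV_mult DERIV_sin d)
    moreover have e: "(1 - cos t) * (2 - (1 - cos t)) = sin t * sin t"
      using sin_cos_squared_add[of t] by (simp add: power2_eq_square algebra_simps)
    have "cos t * psum angq (1 - cos t) + psum (diffs angq) (1 - cos t) * sin t * sin t = 1"
      using psum_angq_ode[OF x] unfolding e by (simp add: mult_ac)
    ultimately show ?thesis by simp
  qed
  have "f \<alpha> = f 0"
  proof (cases "\<alpha> = 0")
    case False
    then show ?thesis using assms D
      by (intro DERIV_isconst2[of 0 \<alpha> f \<alpha>] continuous_at_imp_continuous_on ballI)
         (force dest: DERIV_isCont)+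
  qed simp
  then show ?thesis by (simp add: f_def)
qed

section \<open>Analytic forms of logarithm, exponential and geodesic interpolation\<close>

definition chord :: "'a::real_inner \<Rightarrow> 'a \<Rightarrow> real" where
  "chord a b = ((b - a) \<bullet> (b - a)) / 2"

text \<open>On unit vectors \<open>chord a b\<close> is 1 - cos \<alpha> and the bracket is b - (a
  \<bullet> b) a. In this form every term of the bracket carries b - a, from which order and defect
  are inherited.\<close>

definition glog :: "'a::real_inner \<Rightarrow> 'a \<Rightarrow> 'a" where
  "glog a b = psum angq (chord a b) *\<^sub>R ((b - a) + chord a b *\<^sub>R a)"

text \<open>Like \<open>glog\<close>, it makes sense in any inner product space: one formula serves
  \<open>real^3\<close> and the model space, and it commutes with linear isometries.\<close>

definition gexp :: "'a::real_inner \<Rightarrow> 'a \<Rightarrow> 'a" where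
  "gexp a v = psum cosq (v \<bullet> v) *\<^sub>R a + psum sincq (v \<bullet> v) *\<^sub>R v"

definition gslerp :: "'a::real_inner \<Rightarrow> 'a \<Rightarrow> real \<Rightarrow> 'a" where
  "gslerp a b l = gexp a (l *\<^sub>R glog a b)"

lemma chord_sphere: "norm a = 1 \<Longrightarrow> norm b = 1 \<Longrightarrow> chord a b = 1 - a \<bullet> b"
  by (simp add: chord_def norm_eq_1 inner_diff inner_commute)

lemma inner_less_1:
  fixes a b :: "'a::real_inner"
  assumes "norm a = 1" "norm b = 1" "a \<noteq> b"
  shows "a \<bullet> b < 1"
proof -
  have "0 < (b - a) \<bullet> (b - a)" using assms(3) by (subst inner_gt_zero_iff) auto
  then show ?thesis using chord_sphere[OF assms(1,2)] unfolding chord_def by linarith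
qed

lemma sin_arccos_pos: "- 1 < x \<Longrightarrow> x < 1 \<Longrightarrow> 0 < sin (arccos x)"
  by (intro sin_gt_zero arccos_lt_bounded[THEN conjunct1] arccos_lt_bounded[THEN conjunct2]) auto

text \<open>A positive inner product means \<alpha> < \<pi> / 2, the range in which
  \<open>psum_angq\<close> identifies the series.\<close>

lemma Log_S2_eq_glog:
  assumes "a \<in> S2" "b \<in> S2" "a \<bullet> b > 0"
  shows "Log_S2 a b = glog a b"
proof (cases "b = a")
  case True
  then show ?thesis by (simp add: Log_S2_def glog_def chord_def)
next
  case False
  have n: "norm a = 1" "norm b = 1" using assms by auto
  define \<alpha> where "\<alpha> = arccos (a \<bullet> b)"
  have lt: "a \<bullet> b < 1" using inner_less_1[OF n] False by auto
  then have s: "0 < sin \<alpha>" unfolding \<alpha>_def using assms(3) by (intro sin_arccos_pos) auto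
  have c: "cos \<alpha> = a \<bullet> b" unfolding \<alpha>_def using lt assms(3) by simp
  have "0 \<le> \<alpha>" "\<alpha> < pi / 2"
    unfolding \<alpha>_def using lt assms(3) arccos_less_arccos[of 0 "a \<bullet> b"] by (auto intro: arccos_lbound)
  then have "sin \<alpha> * psum angq (1 - a \<bullet> b) = \<alpha>" using psum_angq[of \<alpha>] c by simp
  then have "\<alpha> / sin \<alpha> = psum angq (chord a b)"
    using s by (simp add: chord_sphere[OF n] field_simps)
  moreover have "b - (a \<bullet> b) *\<^sub>R a = (b - a) + chord a b *\<^sub>R a"
    by (simp add: chord_sphere[OF n] scaleR_diff_left)
  ultimately show ?thesis using False by (simp add: Log_S2_def glog_def Let_def flip: \<alpha>_def)
qed

lemma Exp_S2_eq_gexp: "Exp_S2 a v = gexp a v"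
proof (cases "v = 0")
  case True
  then show ?thesis using psum_cosq[of 0] by (simp add: Exp_S2_def gexp_def)
next
  case False
  then have "sin (norm v) / norm v = psum sincq ((norm v)\<^sup>2)"
    using psum_sincq[of "norm v"] by (simp add: field_simps)
  then show ?thesis using False psum_cosq[of "norm v"] by (simp add: Exp_S2_def gexp_def power2_norm_eq_inner)
qed

lemma SLERP_eq_gslerp: "a \<in> S2 \<Longrightarrow> b \<in> S2 \<Longrightarrow> a \<bullet> b > 0 \<Longrightarrow> SLERP a b l = gslerp a b l"
  by (simp add: SLERP_def gslerp_def Exp_S2_eq_gexp Log_S2_eq_glog)

lemma Log_S2_cases:
  assumes "a \<in> S2" "b \<in> S2" "a \<bullet> b > 0" "b \<noteq> a"
  obtains \<alpha> where "cos \<alpha> = a \<bullet> b" "0 < \<alpha>" "0 < sin \<alpha>"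
    "Log_S2 a b = (\<alpha> / sin \<alpha>) *\<^sub>R (b - cos \<alpha> *\<^sub>R a)" "norm (Log_S2 a b) = \<alpha>"
proof -
  have n: "norm a = 1" "norm b = 1" using assms by auto
  define \<alpha> where "\<alpha> = arccos (a \<bullet> b)"
  have lt: "a \<bullet> b < 1" using inner_less_1[OF n] assms(4) by auto
  then have s: "0 < sin \<alpha>" unfolding \<alpha>_def using assms(3) by (intro sin_arccos_pos) auto
  have c: "cos \<alpha> = a \<bullet> b" unfolding \<alpha>_def using lt assms(3) by simp
  have p: "0 < \<alpha>" unfolding \<alpha>_def using lt assms(3) arccos_lt_bounded by auto
  have L: "Log_S2 a b = (\<alpha> / sin \<alpha>) *\<^sub>R (b - cos \<alpha> *\<^sub>R a)"
    using assms(4) by (simp add: Log_S2_def Let_def c flip: \<alpha>_def)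
  have "(norm (b - cos \<alpha> *\<^sub>R a))\<^sup>2 = (sin \<alpha>)\<^sup>2"
    using n unfolding sin_squared_eq c power2_norm_eq_inner
    by (simp add: norm_eq_1 inner_diff inner_commute power2_eq_square)
  then have "norm (b - cos \<alpha> *\<^sub>R a) = sin \<alpha>" using s by (simp add: power2_eq_iff_nonneg)
  then have "norm (Log_S2 a b) = \<alpha>" using L s p by simp
  then show ?thesis using that c p s L by blast
qed

lemma Log_S2_tangent:
  assumes "a \<in> S2"
  shows "a \<bullet> Log_S2 a b = 0"
proof -
  have "a \<bullet> a = 1" using assms by (simp add: norm_eq_1)
  then show ?thesis by (simp add: Log_S2_def Let_def inner_diff_right)
qed

lemma Exp_S2_Log_S2:
  assumes "a \<in> S2" "b \<in> S2" "a \<bullet> b > 0"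
  shows "Exp_S2 a (Log_S2 a b) = b"
proof (cases "b = a")
  case True
  then show ?thesis by (simp add: Log_S2_def Exp_S2_def)
next
  case False
  obtain \<alpha> where \<alpha>: "cos \<alpha> = a \<bullet> b" "0 < \<alpha>" "0 < sin \<alpha>"
    "Log_S2 a b = (\<alpha> / sin \<alpha>) *\<^sub>R (b - cos \<alpha> *\<^sub>R a)" "norm (Log_S2 a b) = \<alpha>"
    using Log_S2_cases[OF assms False] by blast
  have "Exp_S2 a (Log_S2 a b) = cos \<alpha> *\<^sub>R a + (sin \<alpha> / \<alpha>) *\<^sub>R Log_S2 a b"
    using \<alpha>(2,5) by (auto simp: Exp_S2_def)
  also have "\<dots> = b" unfolding \<alpha>(4) using \<alpha>(2,3) by simp
  finally show ?thesis .
qed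

lemma Exp_S2_sphere:
  assumes "a \<in> S2" "a \<bullet> v = 0"
  shows "Exp_S2 a v \<in> S2"
proof (cases "v = 0")
  case False
  have "a \<bullet> a = 1" using assms by (simp add: norm_eq_1)
  then have "Exp_S2 a v \<bullet> Exp_S2 a v = (cos (norm v))\<^sup>2 + (sin (norm v) / norm v)\<^sup>2 * (v \<bullet> v)"
    using False assms(2)
    by (simp add: Exp_S2_def inner_add inner_commute[of v a] power2_eq_square)
  also have "\<dots> = 1"
    using False by (simp add: power2_norm_eq_inner[symmetric] power_divide)
  finally show ?thesis by (simp add: norm_eq_1)
qed (use assms in \<open>simp add: Exp_S2_def\<close>)

lemma SLERP_sphere: "a \<in> S2 \<Longrightarrow> SLERP a b l \<in> S2"
  unfolding SLERP_def by (intro Exp_S2_sphere) (simp_all add: Log_S2_tangent)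

text \<open>Doubling the geodesic from a to b reflects a in the line through b, by the double-angle
  formulas. The extrapolated control points are thus polynomial in the data.\<close>

lemma SLERP_2:
  assumes "a \<in> S2" "b \<in> S2" "a \<bullet> b > 0"
  shows "SLERP a b 2 = (2 * (a \<bullet> b)) *\<^sub>R b - a"
proof (cases "b = a")
  case True
  have "a \<bullet> a = 1" using assms by (simp add: norm_eq_1)
  then show ?thesis using True by (simp add: SLERP_def Log_S2_def Exp_S2_def scaleR_2)
next
  case False
  obtain \<alpha> where \<alpha>: "cos \<alpha> = a \<bullet> b" "0 < \<alpha>" "0 < sin \<alpha>"
    "Log_S2 a b = (\<alpha> / sin \<alpha>) *\<^sub>R (b - cos \<alpha> *\<^sub>R a)" "norm (Log_S2 a b) = \<alpha>"
    using Log_S2_cases[OF assms False] by blast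
  have "SLERP a b 2 = cos (2 * \<alpha>) *\<^sub>R a + (sin (2 * \<alpha>) / (2 * \<alpha>)) *\<^sub>R 2 *\<^sub>R Log_S2 a b"
    using \<alpha>(2,5) by (auto simp: SLERP_def Exp_S2_def)
  also have "\<dots> = cos (2 * \<alpha>) *\<^sub>R a + (2 * cos \<alpha>) *\<^sub>R (b - cos \<alpha> *\<^sub>R a)"
    unfolding \<alpha>(4) using \<alpha>(2,3) by (simp add: sin_double)
  also have "\<dots> = (2 * (a \<bullet> b)) *\<^sub>R b - a"
    unfolding \<alpha>(1)[symmetric] cos_double_cos
    by (simp add: algebra_simps power2_eq_square)
  finally show ?thesis .
qed

lemma gexp_isometry:
  assumes "linear T" "\<And>u v. T u \<bullet> T v = u \<bullet> v"
  shows "T (gexp a v) = gexp (T a) (T v)"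
  using assms by (simp add: gexp_def linear_add linear_scale)

lemma chord_isometry:
  assumes "linear T" "\<And>u v. T u \<bullet> T v = u \<bullet> v"
  shows "chord (T a) (T b) = chord a b"
  using assms(2)[of "b - a" "b - a"] by (simp add: chord_def linear_diff[OF assms(1)])

lemma glog_isometry:
  assumes "linear T" "\<And>u v. T u \<bullet> T v = u \<bullet> v"
  shows "T (glog a b) = glog (T a) (T b)"
  using assms by (simp add: glog_def linear_add linear_scale linear_diff chord_isometry)

lemma gslerp_isometry:
  assumes "linear T" "\<And>u v. T u \<bullet> T v = u \<bullet> v"
  shows "T (gslerp a b l) = gslerp (T a) (T b) l"
  by (simp add: gslerp_def gexp_isometry[OF assms] linear_scale[OF assms(1)] glog_isometry[OF assms])

text \<open>The model space \<open>\<real> \<times> \<real>\<^sup>3\<close> has a base point that does not depend on the curve: the isometric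
  embedding \<open>split_at y\<close> sends \<open>y\<close> to \<open>(1, 0)\<close> and fixes tangent vectors at \<open>y\<close>. This is what
  makes the coefficients universal.\<close>

definition split_at :: "real^3 \<Rightarrow> real^3 \<Rightarrow> real \<times> (real^3)" where
  "split_at y p = (y \<bullet> p, p - (y \<bullet> p) *\<^sub>R y)"

lemma linear_split_at: "linear (split_at y)"
  by (rule linearI) (simp_all add: split_at_def algebra_simps)

lemma split_at_isometry:
  assumes "y \<in> S2"
  shows "split_at y p \<bullet> split_at y q = p \<bullet> q"
proof -
  have "y \<bullet> y = 1" using assms by (simp add: norm_eq_1)
  then show ?thesis by (simp add: split_at_def inner_diff inner_commute[of p y])
qed

lemma split_at_base: "y \<in> S2 \<Longrightarrow> split_at y y = (1, 0)"
  by (simp add: split_at_def norm_eq_1)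

lemma split_at_tangent: "y \<bullet> v = 0 \<Longrightarrow> split_at y v = (0, v)"
  by (simp add: split_at_def)

lemma Log_S2_model:
  assumes "y \<in> S2" "p \<in> S2" "y \<bullet> p > 0"
  shows "Log_S2 y p = snd (glog (1, 0) (split_at y p))"
proof -
  have "(0, Log_S2 y p) = split_at y (glog y p)"
    using split_at_tangent[OF Log_S2_tangent[OF assms(1)], of p] Log_S2_eq_glog[OF assms] by simp
  also have "\<dots> = glog (1, 0) (split_at y p)"
    using glog_isometry[OF linear_split_at split_at_isometry[OF assms(1)], of y p] split_at_base[OF assms(1)]
    by simp
  finally show ?thesis by (metis snd_conv)
qed

lemma split_at_model:
  assumes "y \<in> S2" "p \<in> S2" "y \<bullet> p > 0"
  shows "split_at y p = gexp (1, 0) (0, Log_S2 y p)"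
proof -
  have "split_at y p = split_at y (gexp y (Log_S2 y p))"
    using Exp_S2_Log_S2[OF assms] by (simp add: Exp_S2_eq_gexp)
  then show ?thesis
    using gexp_isometry[OF linear_split_at split_at_isometry[OF assms(1)], of y "Log_S2 y p"]
      split_at_base[OF assms(1)] split_at_tangent[OF Log_S2_tangent[OF assms(1)], of p] by simp
qed

lemma SLERP_model:
  assumes "y \<in> S2" "a \<in> S2" "b \<in> S2" "a \<bullet> b > 0"
  shows "split_at y (SLERP a b l) = gslerp (split_at y a) (split_at y b) l"
  using gslerp_isometry[OF linear_split_at split_at_isometry[OF assms(1)], of a b l]
  by (simp add: SLERP_eq_gslerp[OF assms(2-4)])

section \<open>Taylor expansion in normal coordinates\<close>

lemma iter_deriv_0 [simp]: "iter_deriv 0 f = f"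
  by (simp add: iter_deriv_def)

lemma iter_deriv_Suc: "iter_deriv (Suc k) f t = vector_derivative (iter_deriv k f) (at t)"
  by (simp add: iter_deriv_def)

lemma iter_deriv_Suc2: "iter_deriv (Suc k) f = iter_deriv k (\<lambda>t. vector_derivative f (at t))"
  by (simp add: iter_deriv_def funpow_swap1[of "\<lambda>g t. vector_derivative g (at t)"])

lemma iter_deriv_cong:
  assumes "open U" "\<And>x. x \<in> U \<Longrightarrow> f x = g x" "x \<in> U"
  shows "iter_deriv k f x = iter_deriv k g x"
  using assms(3)
proof (induction k arbitrary: x)
  case (Suc k)
  have "\<forall>\<^sub>F y in nhds x. y \<in> UNIV \<longrightarrow> iter_deriv k f y = iter_deriv k g y"
    using assms(1) Suc by (auto simp: eventually_nhds)
  then show ?case unfolding iter_deriv_Suc by (rule vector_derivative_cong_eq) auto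
qed (use assms in simp)

section \<open>Differentiability and Taylor's formula with bounds uniform in the base
  parameter\<close>

text \<open>\<open>k\<close>-fold differentiability in the second argument on \<open>]-\<delta>, \<delta>[\<close>, with bounds uniform in the
  first argument.\<close>

primrec bdiff :: "real set \<Rightarrow> real \<Rightarrow> nat \<Rightarrow> (real \<Rightarrow> real \<Rightarrow> 'v::real_normed_vector) \<Rightarrow> bool" where
  "bdiff K \<delta> 0 f \<longleftrightarrow> (\<exists>B. \<forall>t\<in>K. \<forall>\<eta>. \<bar>\<eta>\<bar> < \<delta> \<longrightarrow> norm (f t \<eta>) \<le> B)"
| "bdiff K \<delta> (Suc k) f \<longleftrightarrow> (\<exists>B. \<forall>t\<in>K. \<forall>\<eta>. \<bar>\<eta>\<bar> < \<delta> \<longrightarrow> norm (f t \<eta>) \<le> B) \<and>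
     (\<exists>f'. (\<forall>t\<in>K. \<forall>\<eta>. \<bar>\<eta>\<bar> < \<delta> \<longrightarrow> (f t has_vector_derivative f' t \<eta>) (at \<eta>)) \<and> bdiff K \<delta> k f')"

lemma bdiff_bounded: "bdiff K \<delta> k f \<Longrightarrow> \<exists>B. \<forall>t\<in>K. \<forall>\<eta>. \<bar>\<eta>\<bar> < \<delta> \<longrightarrow> norm (f t \<eta>) \<le> B"
  by (cases k) simp_all

lemma bdiff_SucI:
  assumes "\<exists>B. \<forall>t\<in>K. \<forall>\<eta>. \<bar>\<eta>\<bar> < \<delta> \<longrightarrow> norm (f t \<eta>) \<le> B"
    "\<And>t \<eta>. t \<in> K \<Longrightarrow> \<bar>\<eta>\<bar> < \<delta> \<Longrightarrow> (f t has_vector_derivative f' t \<eta>) (at \<eta>)" "bdiff K \<delta> k f'"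
  shows "bdiff K \<delta> (Suc k) f"
  using assms by auto

lemma bdiff_SucE:
  assumes "bdiff K \<delta> (Suc k) f"
  obtains f' where "\<forall>t\<in>K. \<forall>\<eta>. \<bar>\<eta>\<bar> < \<delta> \<longrightarrow> (f t has_vector_derivative f' t \<eta>) (at \<eta>)"
    "bdiff K \<delta> k f'"
  using assms unfolding bdiff.simps by blast

lemma bdiff_Suc: "bdiff K \<delta> (Suc k) f \<Longrightarrow> bdiff K \<delta> k f"
proof (induction k arbitrary: f)
  case (Suc k)
  obtain f' where f': "\<forall>t\<in>K. \<forall>\<eta>. \<bar>\<eta>\<bar> < \<delta> \<longrightarrow> (f t has_vector_derivative f' t \<eta>) (at \<eta>)"
    "bdiff K \<delta> (Suc k) f'" using Suc.prems by (rule bdiff_SucE)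
  show ?case using Suc.IH[OF f'(2)] f'(1) bdiff_bounded[OF Suc.prems] by auto
qed simp

lemma bdiff_const:
  assumes "\<And>t. t \<in> K \<Longrightarrow> norm (g t) \<le> B"
  shows "bdiff K \<delta> k (\<lambda>t \<eta>. g t)"
proof (cases k)
  case (Suc l)
  have z: "bdiff K \<delta> l (\<lambda>t \<eta>. 0)" for l
    by (induction l) (auto intro!: exI[of _ 0] exI[of _ "\<lambda>_ _. 0"])
  show ?thesis unfolding Suc
    by (rule bdiff_SucI[OF _ _ z]) (use assms in \<open>auto intro!: exI[of _ B]\<close>)
qed (use assms in auto)

lemma bdiff_add:
  "bdiff K \<delta> k f \<Longrightarrow> bdiff K \<delta> k g \<Longrightarrow> bdiff K \<delta> k (\<lambda>t \<eta>. f t \<eta> + g t \<eta>)"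
proof (induction k arbitrary: f g)
  case 0
  then obtain B C where "\<forall>t\<in>K. \<forall>\<eta>. \<bar>\<eta>\<bar> < \<delta> \<longrightarrow> norm (f t \<eta>) \<le> B" "\<forall>t\<in>K. \<forall>\<eta>. \<bar>\<eta>\<bar> < \<delta> \<longrightarrow> norm (g t \<eta>) \<le> C"
    by auto
  then show ?case by (auto intro!: exI[of _ "B + C"] norm_triangle_le add_mono)
next
  case (Suc k)
  obtain f' where f': "\<forall>t\<in>K. \<forall>\<eta>. \<bar>\<eta>\<bar> < \<delta> \<longrightarrow> (f t has_vector_derivative f' t \<eta>) (at \<eta>)"
    "bdiff K \<delta> k f'" using Suc.prems(1) by (rule bdiff_SucE)
  obtain g' where g': "\<forall>t\<in>K. \<forall>\<eta>. \<bar>\<eta>\<bar> < \<delta> \<longrightarrow> (g t has_vector_derivative g' t \<eta>) (at \<eta>)"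
    "bdiff K \<delta> k g'" using Suc.prems(2) by (rule bdiff_SucE)
  show ?case
  proof (rule bdiff_SucI)
    show "bdiff K \<delta> k (\<lambda>t \<eta>. f' t \<eta> + g' t \<eta>)" by (rule Suc.IH[OF f'(2) g'(2)])
    show "((\<lambda>\<eta>. f t \<eta> + g t \<eta>) has_vector_derivative f' t \<eta> + g' t \<eta>) (at \<eta>)" if "t \<in> K" "\<bar>\<eta>\<bar> < \<delta>" for t \<eta>
      by (intro has_vector_derivative_add f'(1)[rule_format] g'(1)[rule_format] that)
    show "\<exists>B. \<forall>t\<in>K. \<forall>\<eta>. \<bar>\<eta>\<bar> < \<delta> \<longrightarrow> norm (f t \<eta> + g t \<eta>) \<le> B"
      using bdiff_bounded[OF Suc.IH[OF Suc.prems[THEN bdiff_Suc]]] .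
  qed
qed

lemma bdiff_bilinear:
  assumes B: "bounded_bilinear B"
  shows "bdiff K \<delta> k f \<Longrightarrow> bdiff K \<delta> k g \<Longrightarrow> bdiff K \<delta> k (\<lambda>t \<eta>. B (f t \<eta>) (g t \<eta>))"
proof (induction k arbitrary: f g)
  case 0
  then obtain C D where C: "\<forall>t\<in>K. \<forall>\<eta>. \<bar>\<eta>\<bar> < \<delta> \<longrightarrow> norm (f t \<eta>) \<le> C" and D: "\<forall>t\<in>K. \<forall>\<eta>. \<bar>\<eta>\<bar> < \<delta> \<longrightarrow> norm (g t \<eta>) \<le> D"
    by auto
  obtain M where M: "M > 0" "\<And>u v. norm (B u v) \<le> norm u * norm v * M"
    using bounded_bilinear.pos_bounded[OF B] by blast
  have "norm (B (f t \<eta>) (g t \<eta>)) \<le> C * D * M" if "t \<in> K" "\<bar>\<eta>\<bar> < \<delta>" for t \<eta>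
  proof -
    have "norm (f t \<eta>) \<le> C" "norm (g t \<eta>) \<le> D" using C D that by auto
    moreover have "0 \<le> C" using calculation norm_ge_zero[of "f t \<eta>"] by linarith
    ultimately have "norm (f t \<eta>) * norm (g t \<eta>) * M \<le> C * D * M"
      using M(1) by (intro mult_right_mono mult_mono) auto
    then show ?thesis using M(2)[of "f t \<eta>" "g t \<eta>"] by linarith
  qed
  then show ?case by auto
next
  case (Suc k)
  obtain f' where f': "\<forall>t\<in>K. \<forall>\<eta>. \<bar>\<eta>\<bar> < \<delta> \<longrightarrow> (f t has_vector_derivative f' t \<eta>) (at \<eta>)"
    "bdiff K \<delta> k f'" using Suc.prems(1) by (rule bdiff_SucE)
  obtain g' where g': "\<forall>t\<in>K. \<forall>\<eta>. \<bar>\<eta>\<bar> < \<delta> \<longrightarrow> (g t has_vector_derivative g' t \<eta>) (at \<eta>)"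
    "bdiff K \<delta> k g'" using Suc.prems(2) by (rule bdiff_SucE)
  note fg = Suc.prems[THEN bdiff_Suc]
  show ?case
  proof (rule bdiff_SucI)
    show "bdiff K \<delta> k (\<lambda>t \<eta>. B (f t \<eta>) (g' t \<eta>) + B (f' t \<eta>) (g t \<eta>))"
      by (intro bdiff_add Suc.IH fg f'(2) g'(2))
    show "((\<lambda>\<eta>. B (f t \<eta>) (g t \<eta>)) has_vector_derivative B (f t \<eta>) (g' t \<eta>) + B (f' t \<eta>) (g t \<eta>)) (at \<eta>)"
      if "t \<in> K" "\<bar>\<eta>\<bar> < \<delta>" for t \<eta>
      by (rule bounded_bilinear.has_vector_derivative[OF B f'(1)[rule_format, OF that] g'(1)[rule_format, OF that]])
    show "\<exists>B'. \<forall>t\<in>K. \<forall>\<eta>. \<bar>\<eta>\<bar> < \<delta> \<longrightarrow> norm (B (f t \<eta>) (g t \<eta>)) \<le> B'"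
      using bdiff_bounded[OF Suc.IH[OF fg]] .
  qed
qed

text \<open>Chain rule. The induction generalises the coefficient sequence because differentiation
  replaces \<open>a\<close> by \<open>diffs a\<close>; within 1/2 all these series are
  bounded.\<close>

lemma bdiff_psum:
  fixes f :: "real \<Rightarrow> real \<Rightarrow> real"
  assumes small: "\<And>t \<eta>. t \<in> K \<Longrightarrow> \<bar>\<eta>\<bar> < \<delta> \<Longrightarrow> \<bar>f t \<eta>\<bar> \<le> 1/2"
  shows "unit_radius a \<Longrightarrow> bdiff K \<delta> k f \<Longrightarrow> bdiff K \<delta> k (\<lambda>t \<eta>. psum a (f t \<eta>))"
proof (induction k arbitrary: a)
  case 0
  obtain B where B: "\<And>x. \<bar>x\<bar> \<le> 1/2 \<Longrightarrow> \<bar>psum a x\<bar> \<le> B" using psum_bounded[OF 0(1)] by blast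
  then show ?case using small by auto
next
  case (Suc k)
  obtain f' where f': "\<forall>t\<in>K. \<forall>\<eta>. \<bar>\<eta>\<bar> < \<delta> \<longrightarrow> (f t has_vector_derivative f' t \<eta>) (at \<eta>)"
    "bdiff K \<delta> k f'" using Suc.prems(2) by (rule bdiff_SucE)
  note f = bdiff_Suc[OF Suc.prems(2)]
  show ?case
  proof (rule bdiff_SucI)
    show "bdiff K \<delta> k (\<lambda>t \<eta>. f' t \<eta> * psum (diffs a) (f t \<eta>))"
      by (intro bdiff_bilinear[OF bounded_bilinear_mult] f'(2) Suc.IH unit_radius_diffs Suc.prems(1) f)
    show "((\<lambda>\<eta>. psum a (f t \<eta>)) has_vector_derivative f' t \<eta> * psum (diffs a) (f t \<eta>)) (at \<eta>)"
      if "t \<in> K" "\<bar>\<eta>\<bar> < \<delta>" for t \<eta>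
      using field_vector_diff_chain_at[OF f'(1)[rule_format, OF that] psum_deriv[OF Suc.prems(1)]] small[OF that]
      by (simp add: o_def)
    show "\<exists>B. \<forall>t\<in>K. \<forall>\<eta>. \<bar>\<eta>\<bar> < \<delta> \<longrightarrow> norm (psum a (f t \<eta>)) \<le> B"
      using bdiff_bounded[OF Suc.IH[OF Suc.prems(1) f]] .
  qed
qed

text \<open>Mean value inequality on the interval from -|\<eta>| to |\<eta>|, where |x|^n \<le>
  |\<eta>|^n. The factor 1 / (n + 1) of an exact integration is given up.\<close>

lemma norm_le_power_of_derivative:
  fixes g :: "real \<Rightarrow> 'v::real_normed_vector"
  assumes "g 0 = 0" "\<And>x. \<bar>x\<bar> < \<delta> \<Longrightarrow> (g has_vector_derivative g' x) (at x)"
    and B: "\<And>x. \<bar>x\<bar> < \<delta> \<Longrightarrow> norm (g' x) \<le> B * \<bar>x\<bar> ^ n" "0 \<le> B" and \<eta>: "\<bar>\<eta>\<bar> < \<delta>"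
  shows "norm (g \<eta>) \<le> B * \<bar>\<eta>\<bar> ^ Suc n"
proof -
  have "norm (g \<eta> - g 0) \<le> (B * \<bar>\<eta>\<bar> ^ n) * norm (\<eta> - 0)"
  proof (rule differentiable_bound[of "{-\<bar>\<eta>\<bar>..\<bar>\<eta>\<bar>}" g "\<lambda>x h. h *\<^sub>R g' x"])
    fix x assume x: "x \<in> {-\<bar>\<eta>\<bar>..\<bar>\<eta>\<bar>}"
    then have x': "\<bar>x\<bar> \<le> \<bar>\<eta>\<bar>" "\<bar>x\<bar> < \<delta>" using \<eta> by auto
    show "(g has_derivative (\<lambda>h. h *\<^sub>R g' x)) (at x within {-\<bar>\<eta>\<bar>..\<bar>\<eta>\<bar>})"
      using assms(2)[OF x'(2)] by (simp add: has_vector_derivative_def has_derivative_at_withinI)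
    have "norm (g' x) \<le> B * \<bar>\<eta>\<bar> ^ n"
      using B(1)[OF x'(2)] mult_left_mono[OF power_mono[OF x'(1)] B(2), of n] by simp
    then show "onorm (\<lambda>h. h *\<^sub>R g' x) \<le> B * \<bar>\<eta>\<bar> ^ n"
      by (intro onorm_le) (metis abs_ge_zero mult.commute mult_left_mono norm_scaleR real_norm_def)
  qed auto
  then show ?thesis using assms(1) by (simp add: mult_ac)
qed

lemma iter_deriv_bdiff:
  fixes f :: "real \<Rightarrow> real \<Rightarrow> real^3"
  assumes "\<forall>t\<in>K. \<forall>\<eta>. \<bar>\<eta>\<bar> < \<delta> \<longrightarrow> (f t has_vector_derivative f' t \<eta>) (at \<eta>)"
    "t \<in> K" "\<bar>\<eta>\<bar> < \<delta>"
  shows "iter_deriv (Suc r) (f t) \<eta> = iter_deriv r (f' t) \<eta>"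
  unfolding iter_deriv_Suc2
  by (rule iter_deriv_cong[of "{-\<delta><..<\<delta>}"]) (use assms in \<open>auto intro!: vector_derivative_at\<close>)

lemma iter_deriv_bounded:
  fixes f :: "real \<Rightarrow> real \<Rightarrow> real^3"
  assumes "0 < \<delta>"
  shows "bdiff K \<delta> r f \<Longrightarrow> \<exists>B. \<forall>t\<in>K. norm (iter_deriv r (f t) 0) \<le> B"
proof (induction r arbitrary: f)
  case 0
  then obtain B where "\<forall>t\<in>K. \<forall>\<eta>. \<bar>\<eta>\<bar> < \<delta> \<longrightarrow> norm (f t \<eta>) \<le> B" by auto
  then have "\<forall>t\<in>K. norm (iter_deriv 0 (f t) 0) \<le> B" using assms by simp
  then show ?case by blast
next
  case (Suc r)
  obtain f' where f': "\<forall>t\<in>K. \<forall>\<eta>. \<bar>\<eta>\<bar> < \<delta> \<longrightarrow> (f t has_vector_derivative f' t \<eta>) (at \<eta>)"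
    "bdiff K \<delta> r f'" using Suc.prems(1) by (rule bdiff_SucE)
  show ?case using Suc.IH[OF f'(2)] iter_deriv_bdiff[OF f'(1), of _ 0 r] assms by auto
qed

text \<open>The derivative of the remainder of f at order k + 1 is the remainder of f' at order k,
  so each induction step integrates the previous bound once and keeps the constant.\<close>

lemma Taylor_bdiff:
  fixes f :: "real \<Rightarrow> real \<Rightarrow> real^3"
  assumes "0 < \<delta>"
  shows "bdiff K \<delta> k f \<Longrightarrow> \<exists>B\<ge>0. \<forall>t\<in>K. \<forall>\<eta>. \<bar>\<eta>\<bar> < \<delta> \<longrightarrow>
    norm (f t \<eta> - (\<Sum>r<k. (\<eta> ^ r / fact r) *\<^sub>R iter_deriv r (f t) 0)) \<le> B * \<bar>\<eta>\<bar> ^ k"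
proof (induction k arbitrary: f)
  case 0
  then obtain B where "\<forall>t\<in>K. \<forall>\<eta>. \<bar>\<eta>\<bar> < \<delta> \<longrightarrow> norm (f t \<eta>) \<le> B" by auto
  then show ?case by (auto intro!: exI[of _ "max B 0"] intro: max.coboundedI1)
next
  case (Suc k)
  obtain f' where f': "\<forall>t\<in>K. \<forall>\<eta>. \<bar>\<eta>\<bar> < \<delta> \<longrightarrow> (f t has_vector_derivative f' t \<eta>) (at \<eta>)"
    "bdiff K \<delta> k f'" using Suc.prems(1) by (rule bdiff_SucE)
  obtain B where B: "B \<ge> 0" "\<And>t \<eta>. t \<in> K \<Longrightarrow> \<bar>\<eta>\<bar> < \<delta> \<Longrightarrow>
    norm (f' t \<eta> - (\<Sum>r<k. (\<eta> ^ r / fact r) *\<^sub>R iter_deriv r (f' t) 0)) \<le> B * \<bar>\<eta>\<bar> ^ k"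
    using Suc.IH[OF f'(2)] by auto
  have "norm (f t \<eta> - (\<Sum>r<Suc k. (\<eta> ^ r / fact r) *\<^sub>R iter_deriv r (f t) 0)) \<le> B * \<bar>\<eta>\<bar> ^ Suc k"
    if t: "t \<in> K" and \<eta>: "\<bar>\<eta>\<bar> < \<delta>" for t \<eta>
  proof -
    define g where "g x = f t x - (\<Sum>r<Suc k. (x ^ r / fact r) *\<^sub>R iter_deriv r (f t) 0)" for x
    have g: "g = (\<lambda>x. f t x - (f t 0 + (\<Sum>r<k. (x ^ Suc r / fact (Suc r)) *\<^sub>R iter_deriv r (f' t) 0)))"
      unfolding g_def sum.lessThan_Suc_shift using iter_deriv_bdiff[OF f'(1) t, of 0] assms t by auto
    have "norm (g \<eta>) \<le> B * \<bar>\<eta>\<bar> ^ Suc k"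
    proof (rule norm_le_power_of_derivative[OF _ _ B(2)[OF t] B(1) \<eta>])
      show "g 0 = 0" by (simp add: g)
      fix x assume x: "\<bar>x\<bar> < \<delta>"
      have *: "((\<lambda>x. (x ^ Suc r / fact (Suc r)) *\<^sub>R v) has_vector_derivative (x ^ r / fact r) *\<^sub>R v) (at x)"
        for r and v :: "real^3"
      proof -
        have "((\<lambda>x. x ^ Suc r / fact (Suc r)) has_field_derivative x ^ r / fact r) (at x)"
          using DERIV_cdivide[OF DERIV_pow[of "Suc r" x], of "fact (Suc r)"]
          by (simp del: of_nat_Suc add: fact_Suc)
        then have "((\<lambda>x. (x ^ Suc r / fact (Suc r)) *\<^sub>R v) has_vector_derivative
            (x ^ Suc r / fact (Suc r)) *\<^sub>R 0 + (x ^ r / fact r) *\<^sub>R v) (at x)"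
          by (intro has_vector_derivative_scaleR) (auto intro: has_vector_derivative_const)
        then show ?thesis by simp
      qed
      have "(g has_vector_derivative f' t x - (0 + (\<Sum>r<k. (x ^ r / fact r) *\<^sub>R iter_deriv r (f' t) 0))) (at x)"
        unfolding g
        by (intro has_vector_derivative_diff has_vector_derivative_add has_vector_derivative_const
            has_vector_derivative_sum f'(1)[rule_format, OF t x] *)
      then show "(g has_vector_derivative f' t x - (\<Sum>r<k. (x ^ r / fact r) *\<^sub>R iter_deriv r (f' t) 0)) (at x)"
        by simp
    qed
    then show ?thesis by (simp only: g_def)
  qed
  with B(1) show ?case by blast
qed

text \<open>\<open>K'\<close> serves as a compact neighbourhood of \<open>K\<close>; each derivative
  is continuous and hence bounded on it, which makes the bound independent of t.\<close>

lemma bdiff_curve: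
  assumes I: "smooth_curve_on I \<gamma>" and K': "compact K'" "K' \<subseteq> I"
    and sub: "\<And>t \<eta>. t \<in> K \<Longrightarrow> \<bar>\<eta>\<bar> < \<delta> \<Longrightarrow> t + \<eta> \<in> K'"
  shows "bdiff K \<delta> k (\<lambda>t \<eta>. iter_deriv m \<gamma> (t + \<eta>))"
proof (induction k arbitrary: m)
  have bd: "\<exists>B. \<forall>t\<in>K. \<forall>\<eta>. \<bar>\<eta>\<bar> < \<delta> \<longrightarrow> norm (iter_deriv m \<gamma> (t + \<eta>)) \<le> B" for m
  proof -
    have "continuous_on K' (iter_deriv m \<gamma>)"
      using I K'(2) unfolding smooth_curve_on_def
      by (intro continuous_at_imp_continuous_on ballI differentiable_imp_continuous_within) blast
    then have "bounded (iter_deriv m \<gamma> ` K')"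
      using K'(1) by (intro compact_imp_bounded compact_continuous_image)
    then show ?thesis using sub unfolding bounded_iff by (meson imageI)
  qed
  {
    case 0
    then show ?case using bd by simp
  next
    case (Suc k)
    show ?case
    proof (rule bdiff_SucI[OF bd _ Suc.IH[of "Suc m"]])
      fix t \<eta> assume "t \<in> K" "\<bar>\<eta>\<bar> < \<delta>"
      then have "iter_deriv m \<gamma> differentiable at (t + \<eta>)"
        using I sub K'(2) unfolding smooth_curve_on_def by blast
      then have d: "(iter_deriv m \<gamma> has_vector_derivative iter_deriv (Suc m) \<gamma> (t + \<eta>)) (at (t + \<eta>))"
        unfolding iter_deriv_Suc by (simp add: vector_derivative_works)
      have "((\<lambda>\<eta>. t + \<eta>) has_vector_derivative 1) (at \<eta>)"
        by (auto intro!: derivative_eq_intros)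
      from vector_diff_chain_at[OF this d]
      show "((\<lambda>\<eta>. iter_deriv m \<gamma> (t + \<eta>)) has_vector_derivative iter_deriv (Suc m) \<gamma> (t + \<eta>)) (at \<eta>)"
        by (simp add: o_def)
    qed
  }
qed

lemma bdiff_minus: "bdiff K \<delta> k f \<Longrightarrow> bdiff K \<delta> k g \<Longrightarrow> bdiff K \<delta> k (\<lambda>t \<eta>. f t \<eta> - g t \<eta>)"
  using bdiff_add[OF _ bdiff_bilinear[OF bounded_bilinear_scaleR bdiff_const[of K "\<lambda>t. -1" 1]], of \<delta> k f g]
  by simp

text \<open>By compactness a closed neighbourhood of \<open>K\<close> of some radius e remains in
  the domain, and uniform continuity there gives one \<delta> that works for all base
  points.\<close>

lemma normal_coordinates_bdiff:
  assumes "admissible \<gamma> K"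
  obtains \<delta> where "0 < \<delta>"
    "\<forall>t\<in>K. \<forall>\<eta>. \<bar>\<eta>\<bar> < \<delta> \<longrightarrow> \<gamma> (t + \<eta>) \<in> S2 \<and> \<gamma> t \<bullet> \<gamma> (t + \<eta>) > 0"
    "\<forall>k. bdiff K \<delta> k (\<lambda>t \<eta>. glog (\<gamma> t) (\<gamma> (t + \<eta>)))"
proof -
  obtain I where I: "open I" "smooth_curve_on I \<gamma>" "\<gamma> ` I \<subseteq> S2" "compact K" "K \<subseteq> I"
    using assms unfolding admissible_def by blast
  obtain e where e: "e > 0" "(\<Union>t\<in>K. cball t e) \<subseteq> I"
    using compact_subset_open_imp_cball_epsilon_subset[OF I(4,1,5)] by blast
  define K' where "K' = {t + \<eta> |t \<eta>. t \<in> K \<and> \<eta> \<in> {-e..e}}"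
  have K': "compact K'" unfolding K'_def using I(4) by (intro compact_sums) auto
  have K'I: "K' \<subseteq> I"
  proof
    fix s assume "s \<in> K'"
    then obtain t \<eta> where "s = t + \<eta>" "t \<in> K" "\<bar>\<eta>\<bar> \<le> e" by (auto simp: K'_def abs_le_iff)
    then have "s \<in> cball t e" "t \<in> K" by (auto simp: dist_real_def)
    then show "s \<in> I" using e(2) by blast
  qed
  have "continuous_on K' (iter_deriv 0 \<gamma>)"
    using I K'I unfolding smooth_curve_on_def
    by (intro continuous_at_imp_continuous_on ballI differentiable_imp_continuous_within) blast
  then have "uniformly_continuous_on K' \<gamma>" using K' by (simp add: compact_uniformly_continuous)
  \<comment> \<open>Distance below 1 means \<open>chord\<close> at most 1/2: the inner product is
    then at least 1/2, and the argument of \<open>angq\<close> is in the range of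
    \<open>bdiff_psum\<close>.\<close>
  then obtain d where d: "d > 0" "\<And>s t. s \<in> K' \<Longrightarrow> t \<in> K' \<Longrightarrow> dist s t < d \<Longrightarrow> dist (\<gamma> s) (\<gamma> t) < 1"
    unfolding uniformly_continuous_on_def by (metis zero_less_one)
  define \<delta> where "\<delta> = min d e"
  have \<delta>: "0 < \<delta>" using d(1) e(1) by (simp add: \<delta>_def)
  have inK': "t + \<eta> \<in> K'" if "t \<in> K" "\<bar>\<eta>\<bar> < \<delta>" for t \<eta>
    using that unfolding K'_def \<delta>_def by force
  have sph: "\<gamma> (t + \<eta>) \<in> S2" if "t \<in> K" "\<bar>\<eta>\<bar> < \<delta>" for t \<eta>
    using inK'[OF that] K'I I(3) by blast
  have sph0: "\<gamma> t \<in> S2" if "t \<in> K" for t using that I(3,5) by blast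
  have chord: "0 \<le> chord (\<gamma> t) (\<gamma> (t + \<eta>)) \<and> chord (\<gamma> t) (\<gamma> (t + \<eta>)) \<le> 1/2" if "t \<in> K" "\<bar>\<eta>\<bar> < \<delta>" for t \<eta>
  proof -
    have "norm (\<gamma> (t + \<eta>) - \<gamma> t) < 1"
      using d(2)[OF inK'[OF that] inK'[OF that(1), of 0]] that \<delta> by (simp add: dist_norm \<delta>_def)
    then have "(norm (\<gamma> (t + \<eta>) - \<gamma> t))\<^sup>2 \<le> 1" by (simp add: power_le_one)
    then show ?thesis by (simp add: chord_def power2_norm_eq_inner)
  qed
  have pos: "\<gamma> t \<bullet> \<gamma> (t + \<eta>) > 0" if "t \<in> K" "\<bar>\<eta>\<bar> < \<delta>" for t \<eta>
    using chord[OF that] chord_sphere[of "\<gamma> t" "\<gamma> (t + \<eta>)"] sph[OF that] sph0[OF that(1)] by simp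
  have "bdiff K \<delta> k (\<lambda>t \<eta>. glog (\<gamma> t) (\<gamma> (t + \<eta>)))" for k
  proof -
    have c: "bdiff K \<delta> k (\<lambda>t \<eta>. \<gamma> t)"
      by (rule bdiff_const[where B = 1]) (use sph0 in auto)
    have u: "bdiff K \<delta> k (\<lambda>t \<eta>. \<gamma> (t + \<eta>) - \<gamma> t)"
      using bdiff_minus[OF bdiff_curve[OF I(2) K' K'I inK', of K \<delta> k 0] c] by simp
    have h: "bdiff K \<delta> k (\<lambda>t \<eta>. 1/2::real)" by (rule bdiff_const[where B = "1/2"]) auto
    have ch: "bdiff K \<delta> k (\<lambda>t \<eta>. chord (\<gamma> t) (\<gamma> (t + \<eta>)))"
      using bdiff_bilinear[OF bounded_bilinear_mult h bdiff_bilinear[OF bounded_bilinear_inner u u]]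
      by (simp add: chord_def)
    show ?thesis unfolding glog_def
      by (intro bdiff_bilinear[OF bounded_bilinear_scaleR] bdiff_add bdiff_psum unit_radius_angq ch u c)
         (use chord in auto)
  qed
  with \<delta> sph pos show ?thesis by (intro that) blast+
qed

section \<open>Normal coordinates of the data\<close>

lemma eventually_flt_small:
  assumes "0 < \<delta>"
  shows "eventually (\<lambda>\<omega>. crv \<omega> = \<gamma> \<and> tm \<omega> \<in> K \<and> \<bar>xi \<omega>\<bar> \<le> \<bar>a\<bar> + \<bar>b\<bar> \<and> 0 < stp \<omega> \<and> \<bar>xi \<omega> * stp \<omega>\<bar> < \<delta>)
    (flt \<gamma> K a b)"
proof -
  \<comment> \<open>The summand 1 keeps \<open>M\<close> positive when a = b = 0.\<close>
  define M where "M = \<bar>a\<bar> + \<bar>b\<bar> + 1"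
  have M: "0 < M" by (simp add: M_def)
  have "\<forall>\<^sub>F h in at_right 0. 0 < h \<and> h < \<delta> / M"
    using assms M by (auto simp: eventually_at_right_field intro!: exI[of _ "\<delta> / M"])
  then show ?thesis unfolding eventually_flt
  proof eventually_elim
    case (elim h)
    show ?case
    proof (intro ballI)
      fix t x assume "t \<in> K" "x \<in> {a..b}"
      then have x: "\<bar>x\<bar> \<le> \<bar>a\<bar> + \<bar>b\<bar>" by auto
      then have "\<bar>x\<bar> * h \<le> M * h" using elim by (intro mult_right_mono) (auto simp: M_def)
      also have "\<dots> < \<delta>" using elim M by (simp add: field_simps)
      finally show "crv (Cfg \<gamma> h t x) = \<gamma> \<and> tm (Cfg \<gamma> h t x) \<in> K \<and> \<bar>xi (Cfg \<gamma> h t x)\<bar> \<le> \<bar>a\<bar> + \<bar>b\<bar> \<and>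
          0 < stp (Cfg \<gamma> h t x) \<and> \<bar>xi (Cfg \<gamma> h t x) * stp (Cfg \<gamma> h t x)\<bar> < \<delta>"
        using x \<open>t \<in> K\<close> elim by (simp add: abs_mult)
    qed
  qed
qed

definition base :: "cfg \<Rightarrow> real^3" where "base \<omega> = crv \<omega> (tm \<omega>)"

definition node :: "cfg \<Rightarrow> real^3" where "node \<omega> = crv \<omega> (tm \<omega> - xi \<omega> * stp \<omega>)"

lemma base_shift [simp]: "base (shift \<omega>) = base \<omega>"
  by (simp add: base_def)

lemma uev_node: "uev (\<lambda>\<omega>. base \<omega> \<in> S2 \<and> node \<omega> \<in> S2 \<and> base \<omega> \<bullet> node \<omega> > 0)"
  unfolding uev_def
proof (intro allI impI)
  fix \<gamma> K a b assume adm: "admissible \<gamma> K"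
  obtain \<delta> where \<delta>: "0 < \<delta>"
    "\<forall>t\<in>K. \<forall>\<eta>. \<bar>\<eta>\<bar> < \<delta> \<longrightarrow> \<gamma> (t + \<eta>) \<in> S2 \<and> \<gamma> t \<bullet> \<gamma> (t + \<eta>) > 0"
    "\<forall>k. bdiff K \<delta> k (\<lambda>t \<eta>. glog (\<gamma> t) (\<gamma> (t + \<eta>)))"
    by (rule normal_coordinates_bdiff[OF adm])
  from eventually_flt_small[OF \<delta>(1)]
  show "eventually (\<lambda>\<omega>. base \<omega> \<in> S2 \<and> node \<omega> \<in> S2 \<and> base \<omega> \<bullet> node \<omega> > 0) (flt \<gamma> K a b)"
  proof eventually_elim
    case (elim \<omega>)
    then show ?case using \<delta>(2)[rule_format, of "tm \<omega>" "- (xi \<omega> * stp \<omega>)"] \<delta>(2)[rule_format, of "tm \<omega>" 0] \<delta>(1)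
      by (auto simp: base_def node_def)
  qed
qed

text \<open>The coefficient maps do not know the base point, so tangency is expressed through the
  jet alone: the span lies in any subspace that contains the jet. The component along the pole is
  left free.\<close>

definition Wm :: "(nat \<Rightarrow> real^3) \<Rightarrow> (real \<times> (real^3)) set" where
  "Wm j = UNIV \<times> span (range j)"

abbreviation Ws :: "(nat \<Rightarrow> real^3) \<Rightarrow> real set" where
  "Ws j \<equiv> UNIV"

lemma subspace_Wm: "subspace (Wm j)"
  unfolding Wm_def by (intro subspace_Times subspace_UNIV subspace_span)

text \<open>Taylor's formula for X at \<eta> = - \<xi> h: the coefficient of h^r is (- \<xi>)^r / r!
  times the r-th jet entry. This is where the degree bound originates, and the only expansion that
  uses smoothness of the curve.\<close>

lemma filtered_node_Log: "filtered Wm 1 0 (\<lambda>\<omega>. (0, Log_S2 (base \<omega>) (node \<omega>)))"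
proof -
  \<comment> \<open>Order one requires \<open>c 0 j = 0\<close> for every sequence j, whereas
    \<open>j 0 = 0\<close> is only known for actual jets; hence the separate clause for r =
    0.\<close>
  define c :: "(real \<times> (real^3)) coeffs" where
    "c r j x = (if r = 0 then 0 else ((- x) ^ r / fact r) *\<^sub>R (0, j r))" for r j x
  have "universal Wm 1 0 c"
  proof (rule universalI[OF subspace_Wm])
    show "poly_lt (Wm j) (Suc r - 0) (c r j)" for r j
    proof -
      have "((-1) ^ r / fact r) *\<^sub>R (0, j r) \<in> Wm j" by (auto simp: Wm_def intro: span_scale span_base)
      then have "poly_lt (Wm j) (Suc r) (\<lambda>x. x ^ r *\<^sub>R ((-1) ^ r / fact r) *\<^sub>R (0, j r))"
        by (intro poly_lt_monom subspace_Wm) auto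
      moreover have "c r j = (\<lambda>x. x ^ r *\<^sub>R ((-1) ^ r / fact r) *\<^sub>R (0, j r))" if "r \<noteq> 0"
      proof
        fix x :: real
        have "(- x) ^ r = x ^ r * (-1) ^ r" by (simp add: power_minus[of x])
        then show "c r j x = x ^ r *\<^sub>R ((-1) ^ r / fact r) *\<^sub>R (0, j r)"
          using that by (simp only: c_def) simp
      qed
      moreover have "c 0 j = (\<lambda>x. 0)" by (simp add: c_def fun_eq_iff)
      ultimately show ?thesis using poly_lt_zero[OF subspace_Wm, of j "Suc r"]
        by (cases "r = 0") simp_all
    qed
  qed (auto simp: c_def)
  moreover have "expands (\<lambda>\<omega>. (0, Log_S2 (base \<omega>) (node \<omega>))) (\<lambda>r \<omega>. c r (jet \<omega>) (xi \<omega>))"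
  proof -
    have coeff: "bigO 0 (\<lambda>\<omega>. c r (jet \<omega>) (xi \<omega>))"
      and remainder: "bigO (Suc N) (\<lambda>\<omega>. (0, Log_S2 (base \<omega>) (node \<omega>)) - (\<Sum>r\<le>N. stp \<omega> ^ r *\<^sub>R c r (jet \<omega>) (xi \<omega>)))"
      for r N
    proof -
      {
        fix \<gamma> K a b assume adm: "admissible \<gamma> K"
        obtain \<delta> where \<delta>: "0 < \<delta>"
          "\<forall>t\<in>K. \<forall>\<eta>. \<bar>\<eta>\<bar> < \<delta> \<longrightarrow> \<gamma> (t + \<eta>) \<in> S2 \<and> \<gamma> t \<bullet> \<gamma> (t + \<eta>) > 0"
          and b: "\<forall>k. bdiff K \<delta> k (\<lambda>t \<eta>. glog (\<gamma> t) (\<gamma> (t + \<eta>)))"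
          by (rule normal_coordinates_bdiff[OF adm])
        define X where "X t \<eta> = glog (\<gamma> t) (\<gamma> (t + \<eta>))" for t \<eta>
        have X: "Log_S2 (\<gamma> t) (\<gamma> (t + \<eta>)) = X t \<eta>" if "t \<in> K" "\<bar>\<eta>\<bar> < \<delta>" for t \<eta>
          using \<delta>(2)[rule_format, OF that] \<delta>(2)[rule_format, OF that(1), of 0] \<delta>(1) by (simp add: X_def Log_S2_eq_glog)
        \<comment> \<open>\<open>Log_S2\<close> and \<open>glog\<close> agree for |\<eta>| <
          \<delta>, which determines all derivatives at 0.\<close>
        have jet: "jet \<omega> k = iter_deriv k (X (tm \<omega>)) 0" if "crv \<omega> = \<gamma>" "tm \<omega> \<in> K" for \<omega> k
          unfolding jet_def
          by (rule iter_deriv_cong[of "{-\<delta><..<\<delta>}"]) (use X that \<delta>(1) in auto)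
        have "\<exists>C. eventually (\<lambda>\<omega>. 0 < stp \<omega> \<and> stp \<omega> < 1 \<longrightarrow> norm (c r (jet \<omega>) (xi \<omega>)) \<le> C * stp \<omega> ^ 0) (flt \<gamma> K a b)"
        proof -
          obtain B where B: "\<And>t. t \<in> K \<Longrightarrow> norm (iter_deriv r (X t) 0) \<le> B"
            using iter_deriv_bounded[OF \<delta>(1) b[rule_format, of r]] unfolding X_def by blast
          have "eventually (\<lambda>\<omega>. norm (c r (jet \<omega>) (xi \<omega>)) \<le> (\<bar>a\<bar> + \<bar>b\<bar>) ^ r * \<bar>B\<bar>) (flt \<gamma> K a b)"
            using eventually_flt_small[OF \<delta>(1)]
          proof eventually_elim
            case (elim \<omega>)
            have B': "norm (jet \<omega> r) \<le> \<bar>B\<bar>" using B[of "tm \<omega>"] jet[of \<omega> r] elim by simp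
            have "\<bar>xi \<omega>\<bar> ^ r / fact r \<le> \<bar>xi \<omega>\<bar> ^ r"
              by (simp add: divide_le_eq mult_le_cancel_left1 fact_ge_1)
            also have "\<dots> \<le> (\<bar>a\<bar> + \<bar>b\<bar>) ^ r" using elim by (intro power_mono) auto
            finally have "\<bar>xi \<omega>\<bar> ^ r / fact r * norm (jet \<omega> r) \<le> (\<bar>a\<bar> + \<bar>b\<bar>) ^ r * \<bar>B\<bar>"
              using B' by (intro mult_mono) auto
            then show ?case by (simp add: c_def norm_Pair power_abs)
          qed
          then show ?thesis by (intro exI[of _ "(\<bar>a\<bar> + \<bar>b\<bar>) ^ r * \<bar>B\<bar>"]) (simp add: eventually_mono)
        qed
        moreover have "\<exists>C. eventually (\<lambda>\<omega>. 0 < stp \<omega> \<and> stp \<omega> < 1 \<longrightarrow>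
          norm ((0, Log_S2 (base \<omega>) (node \<omega>)) - (\<Sum>r\<le>N. stp \<omega> ^ r *\<^sub>R c r (jet \<omega>) (xi \<omega>))) \<le> C * stp \<omega> ^ Suc N) (flt \<gamma> K a b)"
        proof -
          obtain B where B: "B \<ge> 0" "\<And>t \<eta>. t \<in> K \<Longrightarrow> \<bar>\<eta>\<bar> < \<delta> \<Longrightarrow>
            norm (X t \<eta> - (\<Sum>r<Suc N. (\<eta> ^ r / fact r) *\<^sub>R iter_deriv r (X t) 0)) \<le> B * \<bar>\<eta>\<bar> ^ Suc N"
            using Taylor_bdiff[OF \<delta>(1) b[rule_format, of "Suc N"]] unfolding X_def by blast
          have "eventually (\<lambda>\<omega>. norm ((0, Log_S2 (base \<omega>) (node \<omega>)) - (\<Sum>r\<le>N. stp \<omega> ^ r *\<^sub>R c r (jet \<omega>) (xi \<omega>)))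
              \<le> (B * (\<bar>a\<bar> + \<bar>b\<bar>) ^ Suc N) * stp \<omega> ^ Suc N) (flt \<gamma> K a b)"
            using eventually_flt_small[OF \<delta>(1)]
          proof eventually_elim
            case (elim \<omega>)
            define \<eta> where "\<eta> = - (xi \<omega> * stp \<omega>)"
            have \<eta>: "\<bar>\<eta>\<bar> < \<delta>" "tm \<omega> \<in> K" using elim by (auto simp: \<eta>_def)
            have L: "Log_S2 (base \<omega>) (node \<omega>) = X (tm \<omega>) \<eta>"
              using X[OF \<eta>(2,1)] elim by (simp add: base_def node_def \<eta>_def)
            \<comment> \<open>This reconciles the clause for r = 0 with the Taylor sum, which
              includes the zeroth term.\<close>
            have "jet \<omega> 0 = 0" by (simp add: jet_def Log_S2_def)
            then have "stp \<omega> ^ r *\<^sub>R c r (jet \<omega>) (xi \<omega>) = (0, (\<eta> ^ r / fact r) *\<^sub>R jet \<omega> r)" for r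
              by (cases "r = 0") (simp_all add: c_def \<eta>_def power_mult_distrib[symmetric] mult.commute zero_prod_def)
            then have "(\<Sum>r\<le>N. stp \<omega> ^ r *\<^sub>R c r (jet \<omega>) (xi \<omega>))
                = (0, \<Sum>r<Suc N. (\<eta> ^ r / fact r) *\<^sub>R iter_deriv r (X (tm \<omega>)) 0)"
              using jet[of \<omega>] elim by (simp add: sum_prod lessThan_Suc_atMost)
            then have "norm ((0, Log_S2 (base \<omega>) (node \<omega>)) - (\<Sum>r\<le>N. stp \<omega> ^ r *\<^sub>R c r (jet \<omega>) (xi \<omega>))) \<le> B * \<bar>\<eta>\<bar> ^ Suc N"
              using B(2)[OF \<eta>(2,1)] by (simp only: L) (simp add: norm_Pair del: sum.lessThan_Suc)
            also have "\<dots> = B * \<bar>xi \<omega>\<bar> ^ Suc N * stp \<omega> ^ Suc N"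
              using elim by (simp add: \<eta>_def abs_mult power_mult_distrib del: power_Suc)
            also have "\<dots> \<le> B * (\<bar>a\<bar> + \<bar>b\<bar>) ^ Suc N * stp \<omega> ^ Suc N"
              using elim B(1) by (intro mult_right_mono mult_left_mono power_mono) auto
            finally show ?case .
          qed
          then show ?thesis by (intro exI[of _ "B * (\<bar>a\<bar> + \<bar>b\<bar>) ^ Suc N"]) (simp add: eventually_mono)
        qed
        ultimately have "(\<exists>C. eventually (\<lambda>\<omega>. 0 < stp \<omega> \<and> stp \<omega> < 1 \<longrightarrow> norm (c r (jet \<omega>) (xi \<omega>)) \<le> C * stp \<omega> ^ 0) (flt \<gamma> K a b))
          \<and> (\<exists>C. eventually (\<lambda>\<omega>. 0 < stp \<omega> \<and> stp \<omega> < 1 \<longrightarrow>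
          norm ((0, Log_S2 (base \<omega>) (node \<omega>)) - (\<Sum>r\<le>N. stp \<omega> ^ r *\<^sub>R c r (jet \<omega>) (xi \<omega>))) \<le> C * stp \<omega> ^ Suc N) (flt \<gamma> K a b))" ..
      }
      note * = this[THEN conjunct1] this[THEN conjunct2]
      show "bigO 0 (\<lambda>\<omega>. c r (jet \<omega>) (xi \<omega>))" by (rule bigO_intro) (rule *(1))
      show "bigO (Suc N) (\<lambda>\<omega>. (0, Log_S2 (base \<omega>) (node \<omega>)) - (\<Sum>r\<le>N. stp \<omega> ^ r *\<^sub>R c r (jet \<omega>) (xi \<omega>)))"
        by (rule bigO_intro) (rule *(2))
    qed
    then show ?thesis unfolding expands_def by blast
  qed
  ultimately show ?thesis unfolding filtered_def by blast
qed

section \<open>Spherical interpolation in the filtered algebra\<close>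

lemma filtered_inner:
  "filtered Wm m d F \<Longrightarrow> filtered Wm m' d' G \<Longrightarrow> filtered Ws (m + m') (d + d') (\<lambda>\<omega>. F \<omega> \<bullet> G \<omega>)"
  by (rule filtered_bilinear[OF bounded_bilinear_inner]) simp_all

lemma filtered_scaleR:
  "filtered Ws m d f \<Longrightarrow> filtered Wm m' d' G \<Longrightarrow> filtered Wm (m + m') (d + d') (\<lambda>\<omega>. f \<omega> *\<^sub>R G \<omega>)"
  by (rule filtered_bilinear[OF bounded_bilinear_scaleR]) (simp_all add: subspace_Wm subspace_scale)

lemma filtered_mult:
  "filtered Ws m d f \<Longrightarrow> filtered Ws m' d' g \<Longrightarrow> filtered Ws (m + m') (d + d') (\<lambda>\<omega>. f \<omega> * g \<omega>)"
  by (rule filtered_bilinear[OF bounded_bilinear_mult]) simp_all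

lemma filtered_real_const: "filtered Ws 0 0 (\<lambda>\<omega>. s)"
  by (rule filtered_const) simp_all

lemma filtered_xi_divide:
  assumes "filtered W m (Suc d) F"
  shows "filtered W m d (\<lambda>\<omega>. (xi \<omega> / s) *\<^sub>R F \<omega>)"
  using filtered_scale[OF filtered_xi[OF assms], of "1 / s"] by simp

lemma filtered_power: "filtered Ws m d f \<Longrightarrow> filtered Ws (k * m) (k * d) (\<lambda>\<omega>. f \<omega> ^ k)"
  by (induction k) (auto intro: filtered_real_const dest: filtered_mult)

lemma bigO_psum:
  assumes "unit_radius a" "filtered Ws 1 d f"
  shows "bigO (Suc N) (\<lambda>\<omega>. psum a (f \<omega>) - (\<Sum>k\<le>N. a k * f \<omega> ^ k))"
proof -
  obtain C where C: "C \<ge> 0" "\<And>x. \<bar>x\<bar> \<le> 1/2 \<Longrightarrow> \<bar>psum a x - (\<Sum>k\<le>N. a k * x ^ k)\<bar> \<le> C * \<bar>x\<bar> ^ Suc N"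
    using psum_Taylor[OF assms(1), where N = N] by auto
  show ?thesis
  proof (rule bigO_bound)
    show "bigO (Suc N) (\<lambda>\<omega>. f \<omega> ^ Suc N)"
      using filtered_bigO[OF filtered_power[OF assms(2), of "Suc N"]] by simp
    have "uev (\<lambda>\<omega>. norm (f \<omega>) < 1/2)"
      by (rule bigO_1_small[OF filtered_bigO[OF assms(2)]]) simp
    then show "uev (\<lambda>\<omega>. norm (psum a (f \<omega>) - (\<Sum>k\<le>N. a k * f \<omega> ^ k)) \<le> C * norm (f \<omega> ^ Suc N))"
      by (rule uev_mono) (use C(2) in \<open>simp add: power_abs abs_mult del: power_Suc\<close>)
  qed (rule C(1))
qed

text \<open>For k \<ge> 1 the power f^k has order km and defect kd, at least those required. The
  constant term is subtracted because it has defect 0 only.\<close>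

lemma filtered_psum_minus:
  assumes a: "unit_radius a" and f: "filtered Ws m d f" and "1 \<le> m"
  shows "filtered Ws m d (\<lambda>\<omega>. psum a (f \<omega>) - a 0)"
proof (rule filtered_series[where Fk = "\<lambda>k \<omega>. if k = 0 then 0 else a k * f \<omega> ^ k"])
  fix k
  show "filtered Ws (max m k) d (\<lambda>\<omega>. if k = 0 then 0 else a k * f \<omega> ^ k)"
  proof (cases k)
    case (Suc l)
    have "max m k \<le> k * m" "d \<le> k * d"
      using mult_le_mono[of 1 k m m] mult_le_mono[of k k 1 m] \<open>1 \<le> m\<close> Suc by auto
    then have "filtered Ws (max m k) d (\<lambda>\<omega>. f \<omega> ^ k)" by (rule filtered_mono[OF filtered_power[OF f]])
    from filtered_scale[OF this, of "a k"] show ?thesis using Suc by simp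
  qed (simp add: filtered_zero)
next
  fix N
  have "psum a (f \<omega>) - a 0 - (\<Sum>k\<le>N. if k = 0 then 0 else a k * f \<omega> ^ k) = psum a (f \<omega>) - (\<Sum>k\<le>N. a k * f \<omega> ^ k)" for \<omega>
    by (simp add: sum.atMost_shift)
  then show "bigO (Suc N) (\<lambda>\<omega>. psum a (f \<omega>) - a 0 - (\<Sum>k\<le>N. if k = 0 then 0 else a k * f \<omega> ^ k))"
    using bigO_psum[OF a filtered_mono[OF f \<open>1 \<le> m\<close> order_refl]] by (simp only:)
qed

lemma filtered_psum:
  assumes "unit_radius a" "filtered Ws 1 0 f"
  shows "filtered Ws 0 0 (\<lambda>\<omega>. psum a (f \<omega>))"
  using filtered_add[OF filtered_mono[OF filtered_psum_minus[OF assms], of 0 0] filtered_real_const[of "a 0"]]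
  by simp

text \<open>As f and g have defect 0 separately, the defect must come from g - f. It is carried
  through the powers by g^(k+1) - f^(k+1) = g (g^k - f^k) + (g - f) f^k, whose order also grows with
  k.\<close>

lemma filtered_psum_difference:
  assumes a: "unit_radius a" and f: "filtered Ws 1 0 f" and g: "filtered Ws 1 0 g"
    and fg: "filtered Ws 0 1 (\<lambda>\<omega>. g \<omega> - f \<omega>)"
  shows "filtered Ws 0 1 (\<lambda>\<omega>. psum a (g \<omega>) - psum a (f \<omega>))"
proof -
  have fg1: "filtered Ws 1 1 (\<lambda>\<omega>. g \<omega> - f \<omega>)" using filtered_order[OF fg] by simp
  have pw: "filtered Ws (max 1 k) 1 (\<lambda>\<omega>. g \<omega> ^ k - f \<omega> ^ k)" for k
  proof (induction k)
    case (Suc k)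
    have 1: "filtered Ws (max 1 (Suc k)) 1 (\<lambda>\<omega>. g \<omega> * (g \<omega> ^ k - f \<omega> ^ k))"
      by (rule filtered_mono[OF filtered_mult[OF g Suc]]) auto
    have 2: "filtered Ws (max 1 (Suc k)) 1 (\<lambda>\<omega>. (g \<omega> - f \<omega>) * f \<omega> ^ k)"
      by (rule filtered_mono[OF filtered_mult[OF fg1 filtered_power[OF f, of k]]]) auto
    show ?case using filtered_add[OF 1 2] by (simp add: algebra_simps)
  qed (simp add: filtered_zero)
  have "filtered Ws 1 1 (\<lambda>\<omega>. psum a (g \<omega>) - psum a (f \<omega>))"
  proof (rule filtered_series[where Fk = "\<lambda>k \<omega>. a k * (g \<omega> ^ k - f \<omega> ^ k)"])
    show "filtered Ws (max 1 k) 1 (\<lambda>\<omega>. a k * (g \<omega> ^ k - f \<omega> ^ k))" for k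
      using filtered_scale[OF pw[of k], of "a k"] by simp
    show "bigO (Suc N) (\<lambda>\<omega>. psum a (g \<omega>) - psum a (f \<omega>) - (\<Sum>k\<le>N. a k * (g \<omega> ^ k - f \<omega> ^ k)))" for N
      using bigO_minus[OF bigO_psum[OF a g, of N] bigO_psum[OF a f, of N]]
      by (simp add: right_diff_distrib sum_subtractf algebra_simps)
  qed
  then show ?thesis by (rule filtered_mono) auto
qed

section \<open>Geodesic interpolation near the pole of the model space\<close>

abbreviation pole :: "real \<times> (real^3)" where "pole \<equiv> (1, 0)"

definition near_pole :: "(cfg \<Rightarrow> real \<times> (real^3)) \<Rightarrow> bool" where
  "near_pole A \<longleftrightarrow> filtered Wm 1 0 (\<lambda>\<omega>. A \<omega> - pole)"

lemma filtered_pole: "filtered Wm 0 0 (\<lambda>\<omega>. pole)"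
  by (rule filtered_const[OF subspace_Wm]) (simp add: Wm_def span_zero)

lemma near_pole_filtered:
  assumes "near_pole A"
  shows "filtered Wm 0 0 A"
  using filtered_add[OF filtered_mono[OF assms[unfolded near_pole_def], of 0 0] filtered_pole] by simp

lemma near_pole_add:
  assumes "near_pole A" "filtered Wm 1 0 (\<lambda>\<omega>. B \<omega> - A \<omega>)"
  shows "near_pole B"
proof -
  have "x - z + (y - x) = y - z" for x y z :: "real \<times> (real^3)" by simp
  from filtered_add[OF assms[unfolded near_pole_def], unfolded this] show ?thesis
    unfolding near_pole_def .
qed

lemma near_pole_pole: "near_pole (\<lambda>\<omega>. pole)"
  unfolding near_pole_def by (simp add: filtered_zero subspace_Wm)

lemma filtered_chord:
  assumes "filtered Wm m d (\<lambda>\<omega>. B \<omega> - A \<omega>)"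
  shows "filtered Ws (m + m) (d + d) (\<lambda>\<omega>. chord (A \<omega>) (B \<omega>))"
  unfolding chord_def using filtered_scale[OF filtered_inner[OF assms assms], of "1/2"] by simp

text \<open>The chord is quadratic in B - A, and the series factor has defect 0, so the logarithm
  inherits the defect of the difference.\<close>

lemma filtered_glog:
  assumes A: "near_pole A" and u: "filtered Wm 1 d (\<lambda>\<omega>. B \<omega> - A \<omega>)"
  shows "filtered Wm 1 d (\<lambda>\<omega>. glog (A \<omega>) (B \<omega>))"
proof -
  note x = filtered_chord[OF u]
  have "filtered Wm 1 d (\<lambda>\<omega>. chord (A \<omega>) (B \<omega>) *\<^sub>R A \<omega>)"
    by (rule filtered_mono[OF filtered_scaleR[OF x near_pole_filtered[OF A]]]) auto
  from filtered_scaleR[OF filtered_psum[OF unit_radius_angq filtered_mono[OF x, of 1 0]] filtered_add[OF u this]]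
  show ?thesis by (simp add: glog_def)
qed

text \<open>Both corrections to B - A carry the factor \<open>chord\<close>, which has defect two if
  the difference has defect one.\<close>

lemma filtered_glog_minus:
  assumes A: "near_pole A" and u: "filtered Wm 1 1 (\<lambda>\<omega>. B \<omega> - A \<omega>)"
  shows "filtered Wm 0 2 (\<lambda>\<omega>. glog (A \<omega>) (B \<omega>) - (B \<omega> - A \<omega>))"
proof -
  define x where "x \<omega> = chord (A \<omega>) (B \<omega>)" for \<omega>
  have x: "filtered Ws 2 2 x" using filtered_chord[OF u] by (simp add: x_def[abs_def] numeral_2_eq_2)
  have xA: "filtered Wm 2 2 (\<lambda>\<omega>. x \<omega> *\<^sub>R A \<omega>)"
    using filtered_scaleR[OF x near_pole_filtered[OF A]] by simp
  have p: "filtered Ws 2 2 (\<lambda>\<omega>. psum angq (x \<omega>) - 1)"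
    using filtered_psum_minus[OF unit_radius_angq x] by simp
  have uxA: "filtered Wm 1 1 (\<lambda>\<omega>. (B \<omega> - A \<omega>) + x \<omega> *\<^sub>R A \<omega>)"
    by (rule filtered_add[OF u filtered_mono[OF xA]]) auto
  have "filtered Wm 0 2 (\<lambda>\<omega>. (psum angq (x \<omega>) - 1) *\<^sub>R ((B \<omega> - A \<omega>) + x \<omega> *\<^sub>R A \<omega>) + x \<omega> *\<^sub>R A \<omega>)"
    by (rule filtered_add[OF filtered_mono[OF filtered_scaleR[OF p uxA]] filtered_mono[OF xA]]) auto
  then show ?thesis by (simp add: glog_def x_def algebra_simps)
qed

text \<open>With v the weighted logarithm, the increment is (cos |v| - 1) A + sinc |v| v; both terms
  vanish to order one along with v.\<close>

lemma near_pole_gslerp: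
  assumes A: "near_pole A" and u: "filtered Wm 0 1 (\<lambda>\<omega>. B \<omega> - A \<omega>)"
  shows "near_pole (\<lambda>\<omega>. gslerp (A \<omega>) (B \<omega>) (xi \<omega> / s))"
proof (rule near_pole_add[OF A])
  have u1: "filtered Wm 1 1 (\<lambda>\<omega>. B \<omega> - A \<omega>)" using filtered_order[OF u] by simp
  define v where "v \<omega> = (xi \<omega> / s) *\<^sub>R glog (A \<omega>) (B \<omega>)" for \<omega>
  have v: "filtered Wm 1 0 v"
    unfolding v_def[abs_def] using filtered_xi_divide[of Wm 1 0] filtered_glog[OF A u1] by simp
  have w: "filtered Ws 1 0 (\<lambda>\<omega>. v \<omega> \<bullet> v \<omega>)"
    by (rule filtered_mono[OF filtered_inner[OF v v]]) auto
  have c: "filtered Ws 1 0 (\<lambda>\<omega>. psum cosq (v \<omega> \<bullet> v \<omega>) - 1)"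
    using filtered_psum_minus[OF unit_radius_cosq w] by (simp add: cosq_def)
  have 1: "filtered Wm 1 0 (\<lambda>\<omega>. (psum cosq (v \<omega> \<bullet> v \<omega>) - 1) *\<^sub>R A \<omega>)"
    using filtered_scaleR[OF c near_pole_filtered[OF A]] by simp
  have 2: "filtered Wm 1 0 (\<lambda>\<omega>. psum sincq (v \<omega> \<bullet> v \<omega>) *\<^sub>R v \<omega>)"
    using filtered_scaleR[OF filtered_psum[OF unit_radius_sincq w] v] by simp
  from filtered_add[OF 1 2] show "filtered Wm 1 0 (\<lambda>\<omega>. gslerp (A \<omega>) (B \<omega>) (xi \<omega> / s) - A \<omega>)"
    by (simp add: gslerp_def gexp_def v_def[symmetric] algebra_simps)
qed

text \<open>The initial velocities must agree up to defect two because the weight \<xi> / s uses up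
  one. The logarithms then agree up to defect two by \<open>filtered_glog_minus\<close>, and the
  remaining differences are split factor by factor.\<close>

lemma gslerp_congruence:
  assumes A: "near_pole A" and B: "filtered Wm 0 1 (\<lambda>\<omega>. B \<omega> - A \<omega>)"
    and A': "near_pole A'" and B': "filtered Wm 0 1 (\<lambda>\<omega>. B' \<omega> - A' \<omega>)"
    and AA: "filtered Wm 0 1 (\<lambda>\<omega>. A' \<omega> - A \<omega>)"
    and uu: "filtered Wm 0 2 (\<lambda>\<omega>. (B' \<omega> - A' \<omega>) - (B \<omega> - A \<omega>))"
  shows "filtered Wm 0 1 (\<lambda>\<omega>. gslerp (A' \<omega>) (B' \<omega>) (xi \<omega> / s) - gslerp (A \<omega>) (B \<omega>) (xi \<omega> / s))"
proof -
  have u: "filtered Wm 1 1 (\<lambda>\<omega>. B \<omega> - A \<omega>)" using filtered_order[OF B] by simp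
  have u': "filtered Wm 1 1 (\<lambda>\<omega>. B' \<omega> - A' \<omega>)" using filtered_order[OF B'] by simp
  define L where "L \<omega> = glog (A \<omega>) (B \<omega>)" for \<omega>
  define L' where "L' \<omega> = glog (A' \<omega>) (B' \<omega>)" for \<omega>
  define v where "v \<omega> = (xi \<omega> / s) *\<^sub>R L \<omega>" for \<omega>
  define v' where "v' \<omega> = (xi \<omega> / s) *\<^sub>R L' \<omega>" for \<omega>
  have v: "filtered Wm 1 0 v"
    unfolding v_def[abs_def] L_def using filtered_xi_divide[of Wm 1 0] filtered_glog[OF A u] by simp
  have v': "filtered Wm 1 0 v'"
    unfolding v'_def[abs_def] L'_def using filtered_xi_divide[of Wm 1 0] filtered_glog[OF A' u'] by simp
  have "filtered Wm 0 2 (\<lambda>\<omega>. L' \<omega> - L \<omega>)"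
    using filtered_add[OF filtered_diff[OF filtered_glog_minus[OF A' u'] filtered_glog_minus[OF A u]] uu]
    by (simp add: L_def L'_def algebra_simps)
  then have vv: "filtered Wm 0 1 (\<lambda>\<omega>. v' \<omega> - v \<omega>)"
    using filtered_xi_divide[of Wm 0 1 "\<lambda>\<omega>. L' \<omega> - L \<omega>" s]
    by (simp add: v_def v'_def scaleR_diff_right numeral_2_eq_2)
  have w: "filtered Ws 1 0 (\<lambda>\<omega>. v \<omega> \<bullet> v \<omega>)"
    by (rule filtered_mono[OF filtered_inner[OF v v]]) auto
  have w': "filtered Ws 1 0 (\<lambda>\<omega>. v' \<omega> \<bullet> v' \<omega>)"
    by (rule filtered_mono[OF filtered_inner[OF v' v']]) auto
  have ww: "filtered Ws 0 1 (\<lambda>\<omega>. v' \<omega> \<bullet> v' \<omega> - v \<omega> \<bullet> v \<omega>)"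
    using filtered_mono[OF filtered_inner[OF vv filtered_add[OF v' v]], of 0 1]
    by (simp add: inner_diff_left inner_add_right inner_commute algebra_simps)
  note psd = filtered_psum_difference[OF _ w w' ww]
  have 1: "filtered Wm 0 1 (\<lambda>\<omega>. (psum cosq (v' \<omega> \<bullet> v' \<omega>) - psum cosq (v \<omega> \<bullet> v \<omega>)) *\<^sub>R A' \<omega>)"
    using filtered_scaleR[OF psd[OF unit_radius_cosq] near_pole_filtered[OF A']] by simp
  have 2: "filtered Wm 0 1 (\<lambda>\<omega>. psum cosq (v \<omega> \<bullet> v \<omega>) *\<^sub>R (A' \<omega> - A \<omega>))"
    using filtered_scaleR[OF filtered_psum[OF unit_radius_cosq w] AA] by simp
  have 3: "filtered Wm 0 1 (\<lambda>\<omega>. (psum sincq (v' \<omega> \<bullet> v' \<omega>) - psum sincq (v \<omega> \<bullet> v \<omega>)) *\<^sub>R v' \<omega>)"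
    by (rule filtered_mono[OF filtered_scaleR[OF psd[OF unit_radius_sincq] v']]) auto
  have 4: "filtered Wm 0 1 (\<lambda>\<omega>. psum sincq (v \<omega> \<bullet> v \<omega>) *\<^sub>R (v' \<omega> - v \<omega>))"
    using filtered_scaleR[OF filtered_psum[OF unit_radius_sincq w] vv] by simp
  show ?thesis
    using filtered_add[OF filtered_add[OF 1 2] filtered_add[OF 3 4]]
    by (simp add: gslerp_def gexp_def L_def[symmetric] L'_def[symmetric] v_def[symmetric] v'_def[symmetric] algebra_simps)
qed

section \<open>Points of the construction and their images in the model space\<close>

definition model :: "(cfg \<Rightarrow> real^3) \<Rightarrow> cfg \<Rightarrow> real \<times> (real^3)" where
  "model P \<omega> = split_at (base \<omega>) (P \<omega>)"

text \<open>The invariant of the recursion: it supplies both the geometric side conditions of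
  \<open>SLERP\<close> and the expansion of defect 0.\<close>

definition point :: "(cfg \<Rightarrow> real^3) \<Rightarrow> bool" where
  "point P \<longleftrightarrow> uev (\<lambda>\<omega>. P \<omega> \<in> S2) \<and> near_pole (model P)"

lemma uev_base: "uev (\<lambda>\<omega>. base \<omega> \<in> S2)"
  by (rule uev_mono[OF uev_node]) simp

lemma near_pole_cong: "uev (\<lambda>\<omega>. A \<omega> = B \<omega>) \<Longrightarrow> near_pole A \<Longrightarrow> near_pole B"
  unfolding near_pole_def by (erule filtered_cong[rotated]) (erule uev_mono, simp)

text \<open>Together with \<open>point_near\<close> this makes the logarithm at the exact point
  accessible in the final step.\<close>

lemma point_base: "point base"
proof -
  have "uev (\<lambda>\<omega>. pole = model base \<omega>)"
    by (rule uev_mono[OF uev_base]) (simp add: model_def split_at_base)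
  from near_pole_cong[OF this near_pole_pole] uev_base show ?thesis by (simp add: point_def)
qed

text \<open>The Taylor expansion of the data is in normal coordinates; applying \<open>gexp\<close>
  at the pole turns it into an expansion of the model point itself.\<close>

lemma point_node: "point node"
proof -
  define X :: "cfg \<Rightarrow> real \<times> (real^3)" where "X \<omega> = (0, Log_S2 (base \<omega>) (node \<omega>))" for \<omega>
  have X: "filtered Wm 1 0 X" unfolding X_def[abs_def] by (rule filtered_node_Log)
  have w: "filtered Ws 1 0 (\<lambda>\<omega>. X \<omega> \<bullet> X \<omega>)"
    by (rule filtered_mono[OF filtered_inner[OF X X]]) auto
  have c: "filtered Ws 1 0 (\<lambda>\<omega>. psum cosq (X \<omega> \<bullet> X \<omega>) - 1)"
    using filtered_psum_minus[OF unit_radius_cosq w] by (simp add: cosq_def)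
  have 1: "filtered Wm 1 0 (\<lambda>\<omega>. (psum cosq (X \<omega> \<bullet> X \<omega>) - 1) *\<^sub>R pole)"
    using filtered_scaleR[OF c filtered_pole] by simp
  have 2: "filtered Wm 1 0 (\<lambda>\<omega>. psum sincq (X \<omega> \<bullet> X \<omega>) *\<^sub>R X \<omega>)"
    using filtered_scaleR[OF filtered_psum[OF unit_radius_sincq w] X] by simp
  have "(r - 1) *\<^sub>R z + y = r *\<^sub>R z + y - z" for r and y z :: "real \<times> (real^3)"
    by (simp add: scaleR_diff_left)
  from filtered_add[OF 1 2, unfolded this] have "near_pole (\<lambda>\<omega>. gexp pole (X \<omega>))"
    unfolding near_pole_def gexp_def .
  moreover have "uev (\<lambda>\<omega>. gexp pole (X \<omega>) = model node \<omega>)"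
    by (rule uev_mono[OF uev_node]) (simp add: model_def X_def split_at_model)
  ultimately have "near_pole (model node)" by (rule near_pole_cong[rotated])
  moreover have "uev (\<lambda>\<omega>. node \<omega> \<in> S2)" by (rule uev_mono[OF uev_node]) simp
  ultimately show ?thesis by (simp add: point_def)
qed

lemma model_shift: "model (\<lambda>\<omega>. P (shift \<omega>)) \<omega> = model P (shift \<omega>)"
  by (simp add: model_def)

lemma point_shift_difference:
  "point P \<Longrightarrow> filtered Wm 0 1 (\<lambda>\<omega>. model (\<lambda>\<omega>. P (shift \<omega>)) \<omega> - model P \<omega>)"
  using filtered_shift_difference[of Wm 0 0 "model P"] near_pole_filtered[of "model P"]
  by (simp add: point_def model_shift)

lemma point_add:
  assumes "point P" "filtered Wm 0 1 (\<lambda>\<omega>. model Q \<omega> - model P \<omega>)" "uev (\<lambda>\<omega>. Q \<omega> \<in> S2)"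
  shows "point Q"
proof -
  have "filtered Wm 1 0 (\<lambda>\<omega>. model Q \<omega> - model P \<omega>)"
    by (rule filtered_mono[OF filtered_order[OF assms(2)]]) auto
  then show ?thesis using near_pole_add assms unfolding point_def by blast
qed

lemma point_shift: "point P \<Longrightarrow> point (\<lambda>\<omega>. P (shift \<omega>))"
  by (rule point_add[OF _ point_shift_difference])
     (simp_all only: point_def uev_shift[of "\<lambda>\<omega>. P \<omega> \<in> S2"])

text \<open>Both models are O(h) from the pole, so eventually less than 1 apart, and then the inner
  product is at least 1/2. This discharges the positivity conditions of the closed formulas.\<close>

lemma point_near:
  assumes "point P" "point Q"
  shows "uev (\<lambda>\<omega>. base \<omega> \<in> S2 \<and> P \<omega> \<in> S2 \<and> Q \<omega> \<in> S2 \<and> P \<omega> \<bullet> Q \<omega> > 0)"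
proof -
  have "filtered Wm 1 0 (\<lambda>\<omega>. model Q \<omega> - model P \<omega>)"
    using filtered_diff[of Wm 1 0 "\<lambda>\<omega>. model Q \<omega> - pole" "\<lambda>\<omega>. model P \<omega> - pole"] assms
    by (simp add: point_def near_pole_def)
  then have "uev (\<lambda>\<omega>. norm (model Q \<omega> - model P \<omega>) < 1)"
    by (intro bigO_1_small filtered_bigO) auto
  moreover have "uev (\<lambda>\<omega>. base \<omega> \<in> S2 \<and> P \<omega> \<in> S2 \<and> Q \<omega> \<in> S2)"
    using assms uev_base by (simp add: point_def uev_conj)
  ultimately have "uev (\<lambda>\<omega>. norm (model Q \<omega> - model P \<omega>) < 1 \<and> base \<omega> \<in> S2 \<and> P \<omega> \<in> S2 \<and> Q \<omega> \<in> S2)"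
    by (rule uev_conj)
  then show ?thesis
  proof (rule uev_mono)
    fix \<omega> assume *: "norm (model Q \<omega> - model P \<omega>) < 1 \<and> base \<omega> \<in> S2 \<and> P \<omega> \<in> S2 \<and> Q \<omega> \<in> S2"
    then have "(norm (model Q \<omega> - model P \<omega>))\<^sup>2 \<le> 1" by (simp add: power_le_one)
    then have "chord (model P \<omega>) (model Q \<omega>) \<le> 1/2" by (simp add: chord_def power2_norm_eq_inner)
    moreover have "chord (model P \<omega>) (model Q \<omega>) = chord (P \<omega>) (Q \<omega>)"
      unfolding model_def using * by (intro chord_isometry linear_split_at split_at_isometry) auto
    ultimately show "base \<omega> \<in> S2 \<and> P \<omega> \<in> S2 \<and> Q \<omega> \<in> S2 \<and> P \<omega> \<bullet> Q \<omega> > 0"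
      using * chord_sphere[of "P \<omega>" "Q \<omega>"] by simp
  qed
qed

lemma model_SLERP:
  assumes "point P" "point Q"
  shows "uev (\<lambda>\<omega>. gslerp (model P \<omega>) (model Q \<omega>) (l \<omega>) = model (\<lambda>\<omega>. SLERP (P \<omega>) (Q \<omega>) (l \<omega>)) \<omega>)"
  by (rule uev_mono[OF point_near[OF assms]]) (simp add: model_def SLERP_model)

lemma point_SLERP:
  assumes "point P" "point Q" "filtered Wm 0 1 (\<lambda>\<omega>. model Q \<omega> - model P \<omega>)"
  shows "point (\<lambda>\<omega>. SLERP (P \<omega>) (Q \<omega>) (xi \<omega> / s))"
proof -
  have "near_pole (model (\<lambda>\<omega>. SLERP (P \<omega>) (Q \<omega>) (xi \<omega> / s)))"
    by (rule near_pole_cong[OF model_SLERP[OF assms(1,2)] near_pole_gslerp[OF _ assms(3)]])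
       (use assms(1) in \<open>simp add: point_def\<close>)
  moreover have "uev (\<lambda>\<omega>. SLERP (P \<omega>) (Q \<omega>) (xi \<omega> / s) \<in> S2)"
    by (rule uev_mono[OF point_near[OF assms(1,2)]]) (simp only: SLERP_sphere)
  ultimately show ?thesis by (simp add: point_def)
qed

text \<open>With P \<bullet> Q = 1 - x the reflection is the linear extrapolation 2 Q - P minus 2 x
  Q, and x is quadratic in a difference of defect one.\<close>

lemma point_SLERP_2:
  assumes P: "point P" and Q: "point Q" and PQ: "filtered Wm 0 1 (\<lambda>\<omega>. model Q \<omega> - model P \<omega>)"
  shows "point (\<lambda>\<omega>. SLERP (P \<omega>) (Q \<omega>) 2)"
    and "filtered Wm 0 2 (\<lambda>\<omega>. model (\<lambda>\<omega>. SLERP (P \<omega>) (Q \<omega>) 2) \<omega> - (2 *\<^sub>R model Q \<omega> - model P \<omega>))"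
proof -
  define x where "x \<omega> = chord (model P \<omega>) (model Q \<omega>)" for \<omega>
  have x: "filtered Ws 0 2 x"
    using filtered_chord[OF PQ] by (simp add: x_def[abs_def] numeral_2_eq_2)
  have "filtered Wm 0 2 (\<lambda>\<omega>. x \<omega> *\<^sub>R model Q \<omega>)"
    using filtered_scaleR[OF x near_pole_filtered] Q by (simp add: point_def)
  from filtered_scale[OF this, of "-2"]
  have "filtered Wm 0 2 (\<lambda>\<omega>. (-2 * x \<omega>) *\<^sub>R model Q \<omega>)" by simp
  moreover have "uev (\<lambda>\<omega>. (-2 * x \<omega>) *\<^sub>R model Q \<omega> =
      model (\<lambda>\<omega>. SLERP (P \<omega>) (Q \<omega>) 2) \<omega> - (2 *\<^sub>R model Q \<omega> - model P \<omega>))"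
  proof (rule uev_mono[OF point_near[OF P Q]])
    fix \<omega> assume *: "base \<omega> \<in> S2 \<and> P \<omega> \<in> S2 \<and> Q \<omega> \<in> S2 \<and> P \<omega> \<bullet> Q \<omega> > 0"
    have "x \<omega> = chord (P \<omega>) (Q \<omega>)"
      unfolding x_def model_def using * by (intro chord_isometry linear_split_at split_at_isometry) auto
    then have "P \<omega> \<bullet> Q \<omega> = 1 - x \<omega>" using * by (simp add: chord_sphere)
    then have "model (\<lambda>\<omega>. SLERP (P \<omega>) (Q \<omega>) 2) \<omega> = (2 * (1 - x \<omega>)) *\<^sub>R model Q \<omega> - model P \<omega>"
      unfolding model_def using * by (simp add: SLERP_2 linear_diff[OF linear_split_at] linear_scale[OF linear_split_at])
    then show "(-2 * x \<omega>) *\<^sub>R model Q \<omega> =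
      model (\<lambda>\<omega>. SLERP (P \<omega>) (Q \<omega>) 2) \<omega> - (2 *\<^sub>R model Q \<omega> - model P \<omega>)"
      by (simp add: algebra_simps)
  qed
  ultimately show *: "filtered Wm 0 2 (\<lambda>\<omega>. model (\<lambda>\<omega>. SLERP (P \<omega>) (Q \<omega>) 2) \<omega> - (2 *\<^sub>R model Q \<omega> - model P \<omega>))"
    by (rule filtered_cong[rotated])
  have "filtered Wm 0 1 (\<lambda>\<omega>. model (\<lambda>\<omega>. SLERP (P \<omega>) (Q \<omega>) 2) \<omega> - model P \<omega>)"
    using filtered_add[OF filtered_mono[OF *, of 0 1] filtered_scale[OF PQ, of 2]]
    by (simp add: algebra_simps scaleR_2)
  moreover have "uev (\<lambda>\<omega>. SLERP (P \<omega>) (Q \<omega>) 2 \<in> S2)"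
    by (rule uev_mono[OF point_near[OF P Q]]) (simp only: SLERP_sphere)
  ultimately show "point (\<lambda>\<omega>. SLERP (P \<omega>) (Q \<omega>) 2)" by (rule point_add[OF P])
qed

section \<open>The SIDER recursion on configurations\<close>

definition stencil2 :: "cfg \<Rightarrow> real^3" where
  "stencil2 \<omega> = (let p0 = node \<omega>; p1 = node (shift \<omega>); p2 = node (shift (shift \<omega>));
     da = SLERP p2 p1 2; db = SLERP p0 p1 2
     in SLERP (SLERP p0 da (xi \<omega> / 2)) (SLERP db p2 (xi \<omega> / 2)) (xi \<omega> / 2))"

lemma point_stencil2: "point stencil2"
proof -
  define p0 where "p0 = node"
  define p1 where "p1 \<omega> = node (shift \<omega>)" for \<omega>
  define p2 where "p2 \<omega> = node (shift (shift \<omega>))" for \<omega>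
  define da where "da \<omega> = SLERP (p2 \<omega>) (p1 \<omega>) 2" for \<omega>
  define db where "db \<omega> = SLERP (p0 \<omega>) (p1 \<omega>) 2" for \<omega>
  define q where "q \<omega> = SLERP (p0 \<omega>) (da \<omega>) (xi \<omega> / 2)" for \<omega>
  define q' where "q' \<omega> = SLERP (db \<omega>) (p2 \<omega>) (xi \<omega> / 2)" for \<omega>
  note minus = filtered_scale[where s = "-1"]
  have p: "point p0" "point p1" "point p2"
    using point_node point_shift[OF point_node] point_shift[OF point_shift[OF point_node]]
    by (simp_all add: p0_def p1_def[abs_def] p2_def[abs_def])
  have d01: "filtered Wm 0 1 (\<lambda>\<omega>. model p1 \<omega> - model p0 \<omega>)"
    using point_shift_difference[OF point_node] by (simp add: p0_def p1_def[abs_def])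
  have d12: "filtered Wm 0 1 (\<lambda>\<omega>. model p2 \<omega> - model p1 \<omega>)"
    using point_shift_difference[OF p(2)] by (simp add: p1_def[abs_def] p2_def[abs_def])
  have d21: "filtered Wm 0 1 (\<lambda>\<omega>. model p1 \<omega> - model p2 \<omega>)" using minus[OF d12] by simp
  \<comment> \<open>The second difference is the shift difference of the first one, so each
    difference contributes one to the defect.\<close>
  have dd: "filtered Wm 0 2 (\<lambda>\<omega>. (model p2 \<omega> - model p1 \<omega>) - (model p1 \<omega> - model p0 \<omega>))"
  proof -
    have "model p2 \<omega> - model p1 \<omega> = model p1 (shift \<omega>) - model p0 (shift \<omega>)" for \<omega>
      by (simp add: p0_def p1_def p2_def model_def)
    then show ?thesis using filtered_shift_difference[OF d01] by (simp add: numeral_2_eq_2)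
  qed
  note da = point_SLERP_2[OF p(3,2) d21, folded da_def]
  note db = point_SLERP_2[OF p(1,2) d01, folded db_def]
  have a0: "filtered Wm 0 1 (\<lambda>\<omega>. model da \<omega> - model p0 \<omega>)"
    using filtered_add[OF filtered_mono[OF da(2), of 0 1] filtered_add[OF d21 d01]]
    by (simp add: algebra_simps scaleR_2)
  have b0: "filtered Wm 0 1 (\<lambda>\<omega>. model db \<omega> - model p0 \<omega>)"
    using filtered_add[OF filtered_mono[OF db(2), of 0 1] filtered_scale[OF d01, of 2]]
    by (simp add: algebra_simps scaleR_2)
  have 2: "filtered Wm 0 1 (\<lambda>\<omega>. model p2 \<omega> - model db \<omega>)"
    using filtered_diff[OF filtered_add[OF d12 d01] b0] by (simp add: algebra_simps)
  \<comment> \<open>Up to defect two, da = 2 p1 - p2 and db = 2 p1 - p0, hence (p2 - db) - (da - p0)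
    = 2 (p2 - 2 p1 + p0).\<close>
  have uu: "filtered Wm 0 2 (\<lambda>\<omega>. (model p2 \<omega> - model db \<omega>) - (model da \<omega> - model p0 \<omega>))"
    using filtered_diff[OF filtered_diff[OF filtered_scale[OF dd, of 2] da(2)] db(2)]
    by (simp add: algebra_simps scaleR_2)
  have qm: "filtered Wm 0 1 (\<lambda>\<omega>. gslerp (model db \<omega>) (model p2 \<omega>) (xi \<omega> / 2) - gslerp (model p0 \<omega>) (model da \<omega>) (xi \<omega> / 2))"
    by (rule gslerp_congruence) (use p da(1) db(1) a0 b0 2 uu in \<open>simp_all add: point_def\<close>)
  have "point q" "point q'"
    unfolding q_def[abs_def] q'_def[abs_def]
    by (rule point_SLERP[OF p(1) da(1) a0] point_SLERP[OF db(1) p(3) 2])+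
  moreover have "filtered Wm 0 1 (\<lambda>\<omega>. model q' \<omega> - model q \<omega>)"
    by (rule filtered_cong[OF uev_mono[OF uev_conj[OF model_SLERP[OF p(1) da(1), where l = "\<lambda>\<omega>. xi \<omega> / 2"]
        model_SLERP[OF db(1) p(3), where l = "\<lambda>\<omega>. xi \<omega> / 2"]]] qm])
       (simp add: q_def[abs_def] q'_def[abs_def])
  ultimately have "point (\<lambda>\<omega>. SLERP (q \<omega>) (q' \<omega>) (xi \<omega> / 2))" by (rule point_SLERP)
  moreover have "stencil2 = (\<lambda>\<omega>. SLERP (q \<omega>) (q' \<omega>) (xi \<omega> / 2))"
    by (simp add: fun_eq_iff stencil2_def Let_def q_def q'_def da_def db_def p0_def p1_def p2_def)
  ultimately show ?thesis by simp
qed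

text \<open>The index counts levels above 2, so \<open>stencil (Suc k)\<close> is level k + 3, which
  is the divisor of its weight.\<close>

primrec stencil :: "nat \<Rightarrow> cfg \<Rightarrow> real^3" where
  "stencil 0 = stencil2"
| "stencil (Suc k) = (\<lambda>\<omega>. SLERP (stencil k \<omega>) (stencil k (shift \<omega>)) (xi \<omega> / real (k + 3)))"

lemma point_stencil: "point (stencil k)"
proof (induction k)
  case (Suc k)
  from point_SLERP[OF Suc point_shift[OF Suc] point_shift_difference[OF Suc], of "real (k + 3)"]
  show ?case by simp
qed (simp add: point_stencil2)

text \<open>With t = \<theta> h and \<xi> = \<theta> - i the node parameter t - \<xi> h is i h, and
  the shift raises i by one. The induction is over all i because a level uses two neighbouring
  stencils.\<close>

lemma SIDER_eq_stencil: "SIDER \<gamma> h (k + 2) i \<theta> = stencil k (Cfg \<gamma> h (\<theta> * h) (\<theta> - of_int i))"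
proof (induction k arbitrary: i)
  case 0
  have n: "node (Cfg \<gamma> h (\<theta> * h) (\<theta> - of_int j)) = \<gamma> (of_int j * h)" for j
    by (simp add: node_def algebra_simps)
  have s: "shift (Cfg \<gamma> h (\<theta> * h) (\<theta> - of_int j)) = Cfg \<gamma> h (\<theta> * h) (\<theta> - of_int (j + 1))" for j
    by (simp add: shift_def)
  show ?case
    by (subst SIDER.simps) (simp add: SIDER2_def stencil2_def Let_def s n del: of_int_add, simp add: add_ac)
next
  case (Suc k)
  have s: "shift (Cfg \<gamma> h (\<theta> * h) (\<theta> - of_int i)) = Cfg \<gamma> h (\<theta> * h) (\<theta> - of_int (i + 1))"
    by (simp add: shift_def)
  show ?case
    using Suc.IH[of i] Suc.IH[of "i + 1"]
    by (subst SIDER.simps) (simp add: s del: of_int_add, simp add: add.commute)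
qed

section \<open>Extraction of the coefficient maps and the uniform error bound\<close>

theorem proposition5:
  fixes n :: nat
  assumes "n \<ge> 2"
  shows "\<exists>E :: nat \<Rightarrow> real \<Rightarrow> (real^3) list \<Rightarrow> real^3.
    (\<forall>r. \<forall>y\<in>S2. \<forall>J. length J = r \<and> set J \<subseteq> tangent_S2 y \<longrightarrow>
        polynomial_deg_le r (tangent_S2 y) (\<lambda>\<xi>. E r \<xi> J)) \<and>
    (\<forall>(N::nat) (I::real set) (\<gamma>::real \<Rightarrow> real^3) (K::real set) (a::real) (b::real).
        open I \<and> is_interval I \<and> smooth_curve_on I \<gamma> \<and> \<gamma> ` I \<subseteq> S2 \<and>
        compact K \<and> K \<subseteq> I \<longrightarrow>
        (\<exists>C. \<forall>\<^sub>F h in at_right 0. \<forall>(i::int) (\<theta>::real).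
            \<theta> - of_int i \<in> {a..b} \<and> \<theta> * h \<in> K \<longrightarrow>
            norm (Log_S2 (\<gamma> (\<theta> * h)) (SIDER \<gamma> h n i \<theta>)
                  - (\<Sum>r\<le>N. h ^ r *\<^sub>R E r (\<theta> - of_int i) (normal_jet r \<gamma> (\<theta> * h))))
              \<le> C * h ^ (N + 1)))"
proof -
  obtain k where k: "n = k + 2" using assms by (metis add.commute le_Suc_ex)
  define P where "P = stencil k"
  have P: "point P" unfolding P_def by (rule point_stencil)
  \<comment> \<open>The normal-coordinate error is the tangential component of this logarithm, taken
    at the constant pole.\<close>
  have "filtered Wm 1 0 (\<lambda>\<omega>. glog pole (model P \<omega>))"
    by (rule filtered_glog[OF near_pole_pole]) (use P in \<open>simp add: point_def near_pole_def\<close>)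
  then obtain c where c: "universal Wm 1 0 c"
    and ex: "expands (\<lambda>\<omega>. glog pole (model P \<omega>)) (\<lambda>r \<omega>. c r (jet \<omega>) (xi \<omega>))"
    by (rule filteredE)
  \<comment> \<open>The list starts with the first derivative, hence the index m - 1. Padding by 0
    gives entry 0 its true value and keeps all entries tangent.\<close>
  define ext :: "(real^3) list \<Rightarrow> nat \<Rightarrow> real^3" where
    "ext J m = (if 1 \<le> m \<and> m \<le> length J then J ! (m - 1) else 0)" for J m
  define E where "E r \<xi> J = snd (c r (ext J) \<xi>)" for r \<xi> J
  have poly: "polynomial_deg_le r (tangent_S2 y) (\<lambda>\<xi>. E r \<xi> J)" if "set J \<subseteq> tangent_S2 y" for r y J
  proof -
    have sub: "subspace (tangent_S2 y)"
      by (auto simp: tangent_S2_def subspace_def inner_add_left)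
    have "range (ext J) \<subseteq> tangent_S2 y"
    proof clarify
      fix m
      show "ext J m \<in> tangent_S2 y"
      proof (cases "1 \<le> m \<and> m \<le> length J")
        case True
        then have "J ! (m - 1) \<in> set J" by (intro nth_mem) auto
        then show ?thesis using True that by (auto simp: ext_def)
      next
        case False
        then show ?thesis using subspace_0[OF sub] by (auto simp: ext_def)
      qed
    qed
    \<comment> \<open>Tangency passes from the jet to its span and so to all coefficients.\<close>
    then have "snd ` Wm (ext J) \<subseteq> tangent_S2 y"
      using span_minimal[OF _ sub] by (auto simp: Wm_def)
    from poly_lt_linear[OF bounded_linear.linear[OF bounded_linear_snd] this universalD(2)[OF c]]
    show ?thesis
      unfolding polynomial_deg_le_def poly_lt_def E_def
      by (simp add: lessThan_Suc_atMost less_Suc_eq_le)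
  qed
  have jets: "snd (c r (jet (Cfg \<gamma> h t x)) x) = E r x (normal_jet r \<gamma> t)" for r \<gamma> h t x
  proof -
    have "jet (Cfg \<gamma> h t x) m = ext (normal_jet r \<gamma> t) m" if "m \<le> r" for m
    proof (cases "m = 0")
      case True
      then show ?thesis by (simp add: jet_def ext_def Log_S2_def)
    next
      case False
      have "[1..<Suc r] ! (m - 1) = m" using that False by (subst nth_upt) auto
      then show ?thesis using that False by (simp add: jet_def ext_def normal_jet_def del: upt_Suc)
    qed
    \<comment> \<open>\<open>c r\<close> sees only entries up to r, on which the padded list agrees
      with the full jet.\<close>
    then show ?thesis using universalD(4)[OF c, of r "jet (Cfg \<gamma> h t x)" "ext (normal_jet r \<gamma> t)"]
      by (simp add: E_def)
  qed
  have "\<exists>C. \<forall>\<^sub>F h in at_right 0. \<forall>(i::int) (\<theta>::real).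
            \<theta> - of_int i \<in> {a..b} \<and> \<theta> * h \<in> K \<longrightarrow>
            norm (Log_S2 (\<gamma> (\<theta> * h)) (SIDER \<gamma> h n i \<theta>)
                  - (\<Sum>r\<le>N. h ^ r *\<^sub>R E r (\<theta> - of_int i) (normal_jet r \<gamma> (\<theta> * h))))
              \<le> C * h ^ (N + 1)" if adm: "admissible \<gamma> K" for N \<gamma> K a b
  proof -
    have "bigO (Suc N) (\<lambda>\<omega>. snd (glog pole (model P \<omega>) - (\<Sum>r\<le>N. stp \<omega> ^ r *\<^sub>R c r (jet \<omega>) (xi \<omega>))))"
      by (rule bigO_linear[OF bounded_linear_snd expands_remainder[OF ex]])
    moreover have "uev (\<lambda>\<omega>. snd (glog pole (model P \<omega>) - (\<Sum>r\<le>N. stp \<omega> ^ r *\<^sub>R c r (jet \<omega>) (xi \<omega>)))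
       = Log_S2 (base \<omega>) (P \<omega>) - (\<Sum>r\<le>N. stp \<omega> ^ r *\<^sub>R snd (c r (jet \<omega>) (xi \<omega>))))"
      by (rule uev_mono[OF point_near[OF point_base P]]) (simp add: model_def Log_S2_model snd_sum)
    ultimately have "bigO (Suc N) (\<lambda>\<omega>. Log_S2 (base \<omega>) (P \<omega>) - (\<Sum>r\<le>N. stp \<omega> ^ r *\<^sub>R snd (c r (jet \<omega>) (xi \<omega>))))"
      by (rule bigO_cong[rotated])
    then obtain C where "eventually (\<lambda>\<omega>. norm (Log_S2 (base \<omega>) (P \<omega>) - (\<Sum>r\<le>N. stp \<omega> ^ r *\<^sub>R snd (c r (jet \<omega>) (xi \<omega>))))
        \<le> C * stp \<omega> ^ Suc N) (flt \<gamma> K a b)"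
      using adm unfolding bigO_def by blast
    then have "\<forall>\<^sub>F h in at_right 0. \<forall>(i::int) (\<theta>::real).
            \<theta> - of_int i \<in> {a..b} \<and> \<theta> * h \<in> K \<longrightarrow>
            norm (Log_S2 (\<gamma> (\<theta> * h)) (SIDER \<gamma> h n i \<theta>)
                  - (\<Sum>r\<le>N. h ^ r *\<^sub>R E r (\<theta> - of_int i) (normal_jet r \<gamma> (\<theta> * h))))
              \<le> C * h ^ (N + 1)"
      unfolding eventually_flt
    proof eventually_elim
      case (elim h)
      show ?case
      proof (intro allI impI)
        \<comment> \<open>A single bound over \<open>K\<close> and \<open>{a..b}\<close> covers all
          stencils, with t = \<theta> h and \<xi> = \<theta> - i.\<close>
        fix i :: int and \<theta> :: real assume "\<theta> - of_int i \<in> {a..b} \<and> \<theta> * h \<in> K"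
        with bspec[OF bspec[OF elim, of "\<theta> * h"], of "\<theta> - of_int i"]
        show "norm (Log_S2 (\<gamma> (\<theta> * h)) (SIDER \<gamma> h n i \<theta>)
                  - (\<Sum>r\<le>N. h ^ r *\<^sub>R E r (\<theta> - of_int i) (normal_jet r \<gamma> (\<theta> * h))))
              \<le> C * h ^ (N + 1)"
          unfolding k SIDER_eq_stencil by (simp add: P_def base_def jets)
      qed
    qed
    then show ?thesis by blast
  qed
  then have "\<forall>(N::nat) (I::real set) (\<gamma>::real \<Rightarrow> real^3) (K::real set) (a::real) (b::real).
        open I \<and> is_interval I \<and> smooth_curve_on I \<gamma> \<and> \<gamma> ` I \<subseteq> S2 \<and>
        compact K \<and> K \<subseteq> I \<longrightarrow>
        (\<exists>C. \<forall>\<^sub>F h in at_right 0. \<forall>(i::int) (\<theta>::real).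
            \<theta> - of_int i \<in> {a..b} \<and> \<theta> * h \<in> K \<longrightarrow>
            norm (Log_S2 (\<gamma> (\<theta> * h)) (SIDER \<gamma> h n i \<theta>)
                  - (\<Sum>r\<le>N. h ^ r *\<^sub>R E r (\<theta> - of_int i) (normal_jet r \<gamma> (\<theta> * h))))
              \<le> C * h ^ (N + 1))"
    unfolding admissible_def by blast
  with poly show ?thesis by (intro exI[of _ E] conjI) auto
qed

end
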